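(* There is a Schauder basis $\mathcal{X}=(x_n)_{n=1}^\infty$ of a Banach space $X$ that is nearly unconditional but is not bounded-oscillation unconditional. Moreover, given $1\le p<\infty$, $\mathcal{X}$ and $X$ can be chosen so that, in addition, there is a constant $C\in[1,\infty)$ with $$\frac1C|A|^{1/p}\le\Bigl\|\sum_{n\in A}\varepsilon_n x_n\Bigr\|\le C|A|^{1/p}$$ for all finite $A\subset\mathbb{N}$ and all families $(\varepsilon_n)_{n\in A}$ of scalars with $|\varepsilon_n|=1$.
   Context: $\mathbb{N}$ is the set of positive integers; the scalar field $\mathbb{F}$ is $\mathbb{R}$ or $\mathbb{C}$. A basis of a Banach space $X$ is a norm-bounded sequence $(x_n)_{n=1}^\infty$ in $X$ whose linear span is dense in $X$ and for which there is a (unique) norm-bounded sequence $(x_n^* )_{n=1}^\infty$ in $X^*$ with $x_n^*(x_k)=\delta_{n,k}$ for all $n,k$. A Schauder basis of $X$ is a sequence $(x_n)$ such that every $f\in X$ has a unique norm-convergent expansion $f=\sum_n a_nx_n$; the Schauder bases considered are also bases in the previous sense (this is automatic if they are semi-normalized, i.e. $0<\inf_n\|x_n\|\le\sup_n\|x_n\|<\infty$). For a finite set $A\subset\mathbb{N}$, $S_A(f)=\sum_{n\in A}x_n^*(f)x_n$. Write $\|f\|_\infty=\sup_n|x_n^*(f)|$ and, for $0<a\le b<\infty$, $A(f,a,b)=\{n\in\mathbb{N}: a\le|x_n^*(f)|\le b\}$. The basis is nearly unconditional if for each $t\in(0,1]$ there is a constant $C\in(0,\infty)$ such that $\|S_A(f)\|\le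 C\|f\|$ for all $f\in X$, all $s\in(0,\infty)$ with $\|f\|_\infty\le s$, and all $A\subset A(f,ts,s)$. For a nonempty finite $A\subset\mathbb{N}$, $\mathrm{osc}(f,A)=\dfrac{\max_{n\in A}|x_n^*(f)|}{\min_{n\in A}|x_n^*(f)|}$, with $0/0=1$ and $a/0=\infty$ for $a>0$. The basis is bounded-oscillation unconditional if for every $1\le d\le D<\infty$ there is a constant $C$ such that $\|S_A(f)\|\le C\|f\|$ whenever $f\in X$ and $A$ is a nonempty finite subset of $\mathbb{N}$ such that $\mathrm{osc}(f,A)\le D$ and there are $n\in\mathbb{N}$ and a partition $(A_j)_{j=1}^n$ of $A$ into nonempty subsets with $\mathrm{osc}(f,A_j)\le d$ for $1\le j\le n$, $n\le\min(A_1)$, and $\max(A_j)<\min(A_{j+1})$ for $1\le j\le n-1$. *)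

theory Defs
  imports "HOL-Analysis.Analysis" "HOL-Library.Function_Algebras"
begin

text \<open>
  Sequences \<open>x :: nat \<Rightarrow> _\<close> are indexed by the positive integers: only the values at
  \<open>{1..}\<close> matter. The norm \<open>N\<close> is constrained on the carrier \<open>X\<close> only.
\<close>

locale banach_space = vector_space scl
  for scl :: "'k::real_normed_field \<Rightarrow> 'v::ab_group_add \<Rightarrow> 'v" +
  fixes X :: "'v set" and N :: "'v \<Rightarrow> real"
  assumes subspace: "subspace X"
    and norm_nonneg: "f \<in> X \<Longrightarrow> 0 \<le> N f"
    and norm_eq_zero: "f \<in> X \<Longrightarrow> N f = 0 \<longleftrightarrow> f = 0"
    and norm_triangle: "f \<in> X \<Longrightarrow> g \<in> X \<Longrightarrow> N (f + g) \<le> N f + N g"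
    and norm_scale: "f \<in> X \<Longrightarrow> N (scl c f) = norm c * N f"
    and complete:
      "(\<And>n. \<sigma> n \<in> X) \<Longrightarrow>
       (\<And>e. e > 0 \<Longrightarrow> \<exists>M. \<forall>m\<ge>M. \<forall>n\<ge>M. N (\<sigma> m - \<sigma> n) < e) \<Longrightarrow>
       \<exists>f\<in>X. (\<lambda>n. N (\<sigma> n - f)) \<longlonglongrightarrow> 0"

definition linear_functional_on ::
  "('k::real_normed_field \<Rightarrow> 'v::ab_group_add \<Rightarrow> 'v) \<Rightarrow> 'v set \<Rightarrow> ('v \<Rightarrow> 'k) \<Rightarrow> bool" where
  "linear_functional_on scl X \<phi> \<longleftrightarrow>
     (\<forall>f\<in>X. \<forall>g\<in>X. \<phi> (f + g) = \<phi> f + \<phi> g) \<and>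
     (\<forall>c. \<forall>f\<in>X. \<phi> (scl c f) = c * \<phi> f)"

text \<open>
  \<open>basis scl X N x \<phi>\<close>: the sequence \<open>x\<close> is a basis of \<open>X\<close> and \<open>\<phi>\<close> is its sequence of
  coordinate functionals. By \<open>basis_coordinates_unique\<close>, \<open>\<phi>\<close> is determined by \<open>x\<close> on \<open>X\<close>.
\<close>

definition basis ::
  "('k::real_normed_field \<Rightarrow> 'v::ab_group_add \<Rightarrow> 'v) \<Rightarrow> 'v set \<Rightarrow> ('v \<Rightarrow> real) \<Rightarrow>
   (nat \<Rightarrow> 'v) \<Rightarrow> (nat \<Rightarrow> 'v \<Rightarrow> 'k) \<Rightarrow> bool" where
  "basis scl X N x \<phi> \<longleftrightarrow>
     (\<forall>n\<ge>1. x n \<in> X) \<and>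
     (\<exists>B. \<forall>n\<ge>1. N (x n) \<le> B) \<and>
     (\<forall>f\<in>X. \<forall>e>0. \<exists>g\<in>module.span scl (x ` {1..}). N (f - g) < e) \<and>
     (\<forall>n\<ge>1. linear_functional_on scl X (\<phi> n)) \<and>
     (\<exists>B. \<forall>n\<ge>1. \<forall>f\<in>X. norm (\<phi> n f) \<le> B * N f) \<and>
     (\<forall>n\<ge>1. \<forall>k\<ge>1. \<phi> n (x k) = (if n = k then 1 else 0))"

definition schauder_basis ::
  "('k::real_normed_field \<Rightarrow> 'v::ab_group_add \<Rightarrow> 'v) \<Rightarrow> 'v set \<Rightarrow> ('v \<Rightarrow> real) \<Rightarrow>
   (nat \<Rightarrow> 'v) \<Rightarrow> bool" where
  "schauder_basis scl X N x \<longleftrightarrow>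
     (\<forall>n\<ge>1. x n \<in> X) \<and>
     (\<forall>f\<in>X. \<exists>!a. a \<in> extensional {1..} \<and>
        (\<lambda>m. N (f - (\<Sum>n\<in>{1..m}. scl (a n) (x n)))) \<longlonglongrightarrow> 0)"

definition coord_proj ::
  "('k::real_normed_field \<Rightarrow> 'v::ab_group_add \<Rightarrow> 'v) \<Rightarrow> (nat \<Rightarrow> 'v) \<Rightarrow>
   (nat \<Rightarrow> 'v \<Rightarrow> 'k) \<Rightarrow> nat set \<Rightarrow> 'v \<Rightarrow> 'v" where
  "coord_proj scl x \<phi> A f = (\<Sum>n\<in>A. scl (\<phi> n f) (x n))"

definition sup_norm :: "(nat \<Rightarrow> 'v \<Rightarrow> 'k::real_normed_field) \<Rightarrow> 'v \<Rightarrow> real" where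
  "sup_norm \<phi> f = (SUP n\<in>{1..}. norm (\<phi> n f))"

definition level_set ::
  "(nat \<Rightarrow> 'v \<Rightarrow> 'k::real_normed_field) \<Rightarrow> 'v \<Rightarrow> real \<Rightarrow> real \<Rightarrow> nat set" where
  "level_set \<phi> f a b = {n. 1 \<le> n \<and> a \<le> norm (\<phi> n f) \<and> norm (\<phi> n f) \<le> b}"

text \<open>
  For a basis and \<open>a > 0\<close> the set \<open>level_set \<phi> f a b\<close> is finite, because the coordinates
  of \<open>f\<close> tend to \<open>0\<close>; so the sets \<open>A\<close> below are automatically finite.
\<close>

definition nearly_unconditional ::
  "('k::real_normed_field \<Rightarrow> 'v::ab_group_add \<Rightarrow> 'v) \<Rightarrow> 'v set \<Rightarrow> ('v \<Rightarrow> real) \<Rightarrow>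
   (nat \<Rightarrow> 'v) \<Rightarrow> (nat \<Rightarrow> 'v \<Rightarrow> 'k) \<Rightarrow> bool" where
  "nearly_unconditional scl X N x \<phi> \<longleftrightarrow>
     (\<forall>t. 0 < t \<and> t \<le> 1 \<longrightarrow>
       (\<exists>C>0. \<forall>f\<in>X. \<forall>s>0. sup_norm \<phi> f \<le> s \<longrightarrow>
         (\<forall>A. A \<subseteq> level_set \<phi> f (t * s) s \<longrightarrow>
           N (coord_proj scl x \<phi> A f) \<le> C * N f)))"

definition osc ::
  "(nat \<Rightarrow> 'v \<Rightarrow> 'k::real_normed_field) \<Rightarrow> 'v \<Rightarrow> nat set \<Rightarrow> ereal" where
  "osc \<phi> f A =
     (let M = Max ((\<lambda>n. norm (\<phi> n f)) ` A); m = Min ((\<lambda>n. norm (\<phi> n f)) ` A)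
      in if m = 0 then (if M = 0 then 1 else \<infinity>) else ereal (M / m))"

definition bounded_oscillation_unconditional ::
  "('k::real_normed_field \<Rightarrow> 'v::ab_group_add \<Rightarrow> 'v) \<Rightarrow> 'v set \<Rightarrow> ('v \<Rightarrow> real) \<Rightarrow>
   (nat \<Rightarrow> 'v) \<Rightarrow> (nat \<Rightarrow> 'v \<Rightarrow> 'k) \<Rightarrow> bool" where
  "bounded_oscillation_unconditional scl X N x \<phi> \<longleftrightarrow>
     (\<forall>d D :: real. 1 \<le> d \<and> d \<le> D \<longrightarrow>
       (\<exists>C. \<forall>f\<in>X. \<forall>A. finite A \<and> A \<noteq> {} \<and> A \<subseteq> {1..} \<and> osc \<phi> f A \<le> ereal D \<and>
          (\<exists>n\<ge>1. \<exists>P. A = (\<Union>j\<in>{1..n}. P j) \<and> disjoint_family_on P {1..n} \<and>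
             (\<forall>j\<in>{1..n}. P j \<noteq> {} \<and> osc \<phi> f (P j) \<le> ereal d) \<and>
             n \<le> Min (P 1) \<and>
             (\<forall>j\<in>{1..<n}. Max (P j) < Min (P (Suc j))))
          \<longrightarrow> N (coord_proj scl x \<phi> A f) \<le> C * N f))"

definition seq_scale :: "'k::real_normed_field \<Rightarrow> (nat \<Rightarrow> 'k) \<Rightarrow> nat \<Rightarrow> 'k" where
  "seq_scale c f = (\<lambda>n. c * f n)"

lemma vector_space_seq_scale: "vector_space seq_scale"
  by unfold_locales (auto simp: seq_scale_def algebra_simps)

lemma (in banach_space) basis_coordinates_unique:
  assumes "basis scl X N x \<phi>" and "basis scl X N x \<psi>" and n: "n \<ge> 1" and f: "f \<in> X"
  shows "\<phi> n f = \<psi> n f"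
proof -
  obtain B1 B2 where B: "\<And>g. g \<in> X \<Longrightarrow> norm (\<phi> n g) \<le> B1 * N g"
      "\<And>g. g \<in> X \<Longrightarrow> norm (\<psi> n g) \<le> B2 * N g"
    using assms unfolding basis_def by meson
  have lin: "linear_functional_on scl X (\<phi> n)" "linear_functional_on scl X (\<psi> n)"
    and xX: "x ` {1..} \<subseteq> X"
    and eqx: "\<And>k. k \<ge> 1 \<Longrightarrow> \<phi> n (x k) = \<psi> n (x k)"
    using assms unfolding basis_def by auto
  have spanX: "span (x ` {1..}) \<subseteq> X"
    using xX subspace by (rule span_minimal)
  have zero: "\<phi> n 0 = 0" "\<psi> n 0 = 0"
    using lin subspace_0[OF subspace] unfolding linear_functional_on_def
    by (metis mult_zero_left scale_zero_left)+
  have eq: "g \<in> X \<and> \<phi> n g = \<psi> n g" if "g \<in> span (x ` {1..})" for g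
    using that
  proof (induction rule: span_induct_alt)
    case base
    then show ?case using zero subspace_0[OF subspace] by simp
  next
    case (step c y z)
    then obtain k where k: "k \<ge> 1" "y = x k" by auto
    have "y \<in> X" "scl c y \<in> X"
      using k xX subspace_scale[OF subspace] by auto
    then show ?case
      using step k eqx[OF k(1)] lin subspace_add[OF subspace]
      unfolding linear_functional_on_def by metis
  qed
  have bound: "norm (\<phi> n f - \<psi> n f) \<le> (\<bar>B1\<bar> + \<bar>B2\<bar> + 1) * e" if e: "e > 0" for e
  proof -
    obtain g where g: "g \<in> span (x ` {1..})" "N (f - g) < e"
      using assms(1) f e unfolding basis_def by meson
    have gX: "g \<in> X" and h: "f - g \<in> X"
      using g spanX f subspace_diff[OF subspace] by auto
    have "\<phi> n f = \<phi> n g + \<phi> n (f - g)" "\<psi> n f = \<psi> n g + \<psi> n (f - g)"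
      using lin gX h unfolding linear_functional_on_def by (metis add_diff_cancel_left' diff_add_cancel add.commute)+
    then have "norm (\<phi> n f - \<psi> n f) \<le> norm (\<phi> n (f - g)) + norm (\<psi> n (f - g))"
      using eq[OF g(1)] norm_triangle_ineq4 by simp
    also have "\<dots> \<le> (B1 + B2) * N (f - g)"
      using B[OF h] by (simp add: algebra_simps)
    also have "\<dots> \<le> (\<bar>B1\<bar> + \<bar>B2\<bar> + 1) * e"
      using g(2) norm_nonneg[OF h] by (intro mult_mono) auto
    finally show ?thesis .
  qed
  have "norm (\<phi> n f - \<psi> n f) \<le> 0 + e" if "e > 0" for e
    using bound[of "e / (\<bar>B1\<bar> + \<bar>B2\<bar> + 1)"] that by simp
  then have "norm (\<phi> n f - \<psi> n f) \<le> 0"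
    by (rule field_le_epsilon)
  then show ?thesis by simp
qed

end

theory Submission
  imports Defs
begin

text \<open>
  Write \<open>a = 1 / p\<close> and cut the index set into consecutive blocks, the \<open>i\<close>-th one consisting of a
  head of \<open>2 ^ i\<close> indices followed by a tail of \<open>M i \<ge> 4 ^ i\<close> indices. The operator \<open>L\<close> keeps the
  head coordinates of \<open>f\<close> and subtracts from every tail coordinate a multiple of the sum of the head
  coordinates of the same block. The norm of \<open>f\<close> is the supremum of
  \<open>card S powr (a - 1) * (\<Sum>n\<in>S. norm (L g n))\<close> over the truncations \<open>g\<close> of \<open>f\<close> and over the finite
  sets \<open>S\<close> whose heads satisfy a Schreier condition.

  Because \<open>2 ^ i / M i\<close> tends to \<open>0\<close>, the subtraction is negligible at coordinates that are comparable
  with the largest one, up to finitely many indices; hence the norm controls the top level of \<open>f\<close> from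
  below as the norm of weak \<open>\<ell>\<^sub>p\<close> would, which yields near unconditionality and the estimate
  for the fundamental function. On the other hand, the vector with entries \<open>2 powr (- i * a)\<close> on the
  heads and \<open>M i powr - a\<close> on the tails of \<open>k\<close> consecutive blocks has norm at most \<open>5\<close>: the tails
  are cancelled and the Schreier condition sees only boundedly much of the heads. If \<open>M\<close> is constant
  on these blocks, then the tails form one level set, and the restriction to it has norm at least
  \<open>k powr a\<close>.
\<close>

section \<open>Sequence spaces defined by a family of seminorms\<close>

definition trunc :: "nat \<Rightarrow> (nat \<Rightarrow> 'k::zero) \<Rightarrow> nat \<Rightarrow> 'k" where
  "trunc m f = (\<lambda>n. if n \<le> m then f n else 0)"

definition unit_seq :: "nat \<Rightarrow> nat \<Rightarrow> 'k::zero_neq_one" where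
  "unit_seq n = (\<lambda>k. if k = n then 1 else 0)"

lemma sum_fun_apply: "(\<Sum>i\<in>I. F i) n = (\<Sum>i\<in>I. F i n)"
  by (induction I rule: infinite_finite_induct) auto

lemma trunc_eq_sum:
  fixes f :: "nat \<Rightarrow> 'k::real_normed_field"
  assumes "f 0 = 0"
  shows "trunc m f = (\<Sum>n\<in>{1..m}. seq_scale (f n) (unit_seq n))"
proof
  fix k
  have "(\<Sum>n\<in>{1..m}. f n * (if k = n then 1 else 0)) = (\<Sum>n\<in>{1..m}. if k = n then f n else 0)"
    by (intro sum.cong) auto
  then show "trunc m f k = (\<Sum>n\<in>{1..m}. seq_scale (f n) (unit_seq n)) k"
    using assms by (cases "k = 0") (auto simp: trunc_def sum_fun_apply seq_scale_def unit_seq_def)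
qed

lemma coord_proj_unit_seq:
  fixes f :: "nat \<Rightarrow> 'k::real_normed_field"
  assumes "finite A"
  shows "coord_proj seq_scale unit_seq (\<lambda>n f. f n) A f = (\<lambda>n. if n \<in> A then f n else 0)"
proof
  fix k
  have "(\<Sum>n\<in>A. f n * (if k = n then 1 else 0)) = (\<Sum>n\<in>A. if k = n then f n else 0)"
    by (intro sum.cong) auto
  then show "coord_proj seq_scale unit_seq (\<lambda>n f. f n) A f k = (if k \<in> A then f k else 0)"
    using assms by (simp add: coord_proj_def sum_fun_apply seq_scale_def unit_seq_def)
qed

lemma trunc_add: "trunc m (f + g) = trunc m f + trunc m (g :: nat \<Rightarrow> 'k::monoid_add)"
  and trunc_diff: "trunc m (f' - g') = trunc m f' - trunc m (g' :: nat \<Rightarrow> 'l::group_add)"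
  and trunc_scale: "trunc m (seq_scale c h) = seq_scale c (trunc m h)"
  and trunc_trunc: "trunc m (trunc k f) = trunc (min m k) f"
  by (auto simp: trunc_def seq_scale_def fun_eq_iff)

text \<open>By \<open>q_trunc\<close> the family is closed under composition with truncations, which
  makes the partial sum projections contractive. Each single seminorm is continuous for
  coordinatewise convergence, so uniform inequalities pass to coordinatewise limits.\<close>

locale seminorm_family =
  fixes q :: "'j \<Rightarrow> (nat \<Rightarrow> 'k::{real_normed_field,banach}) \<Rightarrow> real" and B K :: real
  assumes q_add: "q j (f + g) \<le> q j f + q j g"
    and q_scale: "q j (seq_scale c f) = norm c * q j f"
    and q_trunc: "\<exists>i. \<forall>f. q j (trunc m f) = q i f"
    and q_unit: "1 \<le> n \<Longrightarrow> q j (unit_seq n) \<le> B"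
    and q_coord: "1 \<le> n \<Longrightarrow> (\<And>j. q j f \<le> r) \<Longrightarrow> norm (f n) \<le> K * r"
    and q_cont: "(\<And>n. (\<lambda>k. \<sigma> k n) \<longlonglongrightarrow> f n) \<Longrightarrow> (\<lambda>k. q j (\<sigma> k)) \<longlonglongrightarrow> q j f"
begin

text \<open>This is the closure of the finitely supported sequences, phrased without
  \<open>N\<close> because the supremum in \<open>N\<close> is meaningful only where the seminorms
  are uniformly bounded. Entry \<open>0\<close> is fixed since \<open>q_coord\<close> does not
  control it.\<close>

definition X :: "(nat \<Rightarrow> 'k) set" where
  "X = {f. f 0 = 0 \<and> (\<forall>e>0. \<exists>M. \<forall>m\<ge>M. \<forall>j. q j (f - trunc m f) \<le> e)}"

definition N :: "(nat \<Rightarrow> 'k) \<Rightarrow> real" where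
  "N f = (SUP j. q j f)"

lemma q_zero: "q j 0 = 0"
  using q_scale[of j 0 0] by (simp add: seq_scale_def zero_fun_def)

lemma q_minus: "q j (- f) = q j f"
  using q_scale[of j "-1" f] by (simp add: seq_scale_def fun_Compl_def)

lemma q_nonneg: "0 \<le> q j f"
  using q_add[of j f "- f"] by (simp add: q_minus q_zero)

lemma q_diff: "q j (f - g) \<le> q j f + q j g"
  using q_add[of j f "- g"] by (simp add: q_minus)

lemma q_sum: "q j (\<Sum>i\<in>I. F i) \<le> (\<Sum>i\<in>I. q j (F i))"
proof (induction I rule: infinite_finite_induct)
  case (insert i I)
  then show ?case using q_add[of j "F i" "sum F I"]
    unfolding sum.insert[OF insert.hyps] by linarith
qed (simp_all add: q_zero[unfolded zero_fun_def])

lemma q_finite_support_bound: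
  assumes "f 0 = 0"
  shows "q j (trunc m f) \<le> (\<Sum>n\<in>{1..m}. norm (f n) * B)"
proof -
  have "q j (trunc m f) \<le> (\<Sum>n\<in>{1..m}. q j (seq_scale (f n) (unit_seq n)))"
    unfolding trunc_eq_sum[of f, OF assms] by (rule q_sum)
  also have "\<dots> \<le> (\<Sum>n\<in>{1..m}. norm (f n) * B)"
    by (intro sum_mono) (auto simp: q_scale intro!: mult_left_mono q_unit)
  finally show ?thesis .
qed

text \<open>The family must be bounded above for \<open>SUP\<close> to be an upper bound: a
  truncation far out leaves a remainder of seminorm at most \<open>1\<close>, and the finite part is
  bounded independently of \<open>j\<close>.\<close>

lemma q_le_N:
  assumes "f \<in> X"
  shows "q j f \<le> N f"
proof -
  obtain m where m: "\<And>j. q j (f - trunc m f) \<le> 1"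
    using assms zero_less_one unfolding X_def by blast
  have "q j f \<le> 1 + (\<Sum>n\<in>{1..m}. norm (f n) * B)" for j
    using q_add[of j "f - trunc m f" "trunc m f"] m[of j] q_finite_support_bound[of f j m] assms
    by (simp add: X_def)
  then have "bdd_above (range (\<lambda>j. q j f))"
    by (auto simp: bdd_above_def)
  then show ?thesis
    unfolding N_def by (rule cSUP_upper[rotated]) simp
qed

lemma N_le: "(\<And>j. q j f \<le> c) \<Longrightarrow> N f \<le> c"
  unfolding N_def by (rule cSUP_least) auto

lemma N_nonneg: "f \<in> X \<Longrightarrow> 0 \<le> N f"
  by (rule order_trans[OF q_nonneg q_le_N])

lemma coord_le_N: "f \<in> X \<Longrightarrow> 1 \<le> n \<Longrightarrow> norm (f n) \<le> K * N f"
  using q_coord q_le_N by blast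

lemma finite_support_in_X:
  assumes "f 0 = 0" "\<And>n. n > m \<Longrightarrow> f n = 0"
  shows "f \<in> X"
proof -
  have "f - trunc k f = 0" if "k \<ge> m" for k
    using assms(2) that by (auto simp: trunc_def fun_eq_iff)
  then show ?thesis
    using assms(1) by (auto simp: X_def q_zero intro!: exI[of _ m])
qed

lemma trunc_in_X: "f 0 = 0 \<Longrightarrow> trunc m f \<in> X"
  by (rule finite_support_in_X[of _ m]) (auto simp: trunc_def)

lemma unit_seq_in_X: "1 \<le> n \<Longrightarrow> unit_seq n \<in> X"
  by (rule finite_support_in_X[of _ n]) (auto simp: unit_seq_def)

section \<open>Linear structure and completeness\<close>

lemma X_add:
  assumes f: "f \<in> X" and g: "g \<in> X"
  shows "f + g \<in> X"
proof -
  have "\<exists>M. \<forall>m\<ge>M. \<forall>j. q j (f + g - trunc m (f + g)) \<le> e" if e: "e > 0" for e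
  proof -
    obtain M1 where M1: "\<And>m j. m \<ge> M1 \<Longrightarrow> q j (f - trunc m f) \<le> e / 2"
      using f half_gt_zero[OF e] unfolding X_def by blast
    obtain M2 where M2: "\<And>m j. m \<ge> M2 \<Longrightarrow> q j (g - trunc m g) \<le> e / 2"
      using g half_gt_zero[OF e] unfolding X_def by blast
    have "q j (f + g - trunc m (f + g)) \<le> e" if "m \<ge> max M1 M2" for m j
    proof -
      have eq: "f + g - trunc m (f + g) = (f - trunc m f) + (g - trunc m g)"
        by (simp add: trunc_add algebra_simps)
      have "q j (f - trunc m f) \<le> e / 2" "q j (g - trunc m g) \<le> e / 2"
        using M1 M2 that by auto
      then show ?thesis
        unfolding eq using q_add[of j "f - trunc m f" "g - trunc m g"] by linarith
    qed
    then show ?thesis by blast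
  qed
  then show ?thesis using f g by (simp add: X_def)
qed

lemma X_scale:
  assumes f: "f \<in> X"
  shows "seq_scale c f \<in> X"
proof -
  have "\<exists>M. \<forall>m\<ge>M. \<forall>j. q j (seq_scale c f - trunc m (seq_scale c f)) \<le> e" if e: "e > 0" for e
  proof -
    have "e / (norm c + 1) > 0" using e by (simp add: add_nonneg_pos)
    then obtain M where M: "\<And>m j. m \<ge> M \<Longrightarrow> q j (f - trunc m f) \<le> e / (norm c + 1)"
      using f unfolding X_def by blast
    have "q j (seq_scale c f - trunc m (seq_scale c f)) \<le> e" if "m \<ge> M" for m j
    proof -
      have "seq_scale c f - trunc m (seq_scale c f) = seq_scale c (f - trunc m f)"
        by (simp add: trunc_def seq_scale_def fun_eq_iff algebra_simps)
      then have "q j (seq_scale c f - trunc m (seq_scale c f)) = norm c * q j (f - trunc m f)"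
        by (simp add: q_scale)
      also have "\<dots> \<le> (norm c + 1) * (e / (norm c + 1))"
        using M[OF that, of j] by (intro mult_mono) (auto simp: q_nonneg)
      also have "\<dots> = e" by (simp add: add_nonneg_eq_0_iff)
      finally show ?thesis .
    qed
    then show ?thesis by blast
  qed
  then show ?thesis using f by (simp add: X_def seq_scale_def)
qed

lemma X_diff:
  assumes "f \<in> X" "g \<in> X"
  shows "f - g \<in> X"
proof -
  have eq: "f - g = f + seq_scale (-1) g"
    by (simp add: seq_scale_def fun_eq_iff)
  show ?thesis unfolding eq using assms by (intro X_add X_scale)
qed

lemma N_zero: "N 0 = 0"
  by (simp add: N_def q_zero)

text \<open>Coordinates converge by \<open>q_coord\<close>, and \<open>q_cont\<close> carries the
  Cauchy estimate, uniformly in \<open>j\<close>, to the coordinatewise limit \<open>f\<close>. It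
  then remains to place \<open>f\<close> in \<open>X\<close>.\<close>

lemma X_complete:
  assumes \<sigma>: "\<And>n. \<sigma> n \<in> X"
    and cauchy: "\<And>e. e > 0 \<Longrightarrow> \<exists>M. \<forall>m\<ge>M. \<forall>n\<ge>M. N (\<sigma> m - \<sigma> n) < e"
  shows "\<exists>f\<in>X. (\<lambda>n. N (\<sigma> n - f)) \<longlonglongrightarrow> 0"
proof -
  have "convergent (\<lambda>k. \<sigma> k n)" for n
  proof (cases "n = 0")
    case True
    then show ?thesis using \<sigma> by (simp add: X_def convergent_const)
  next
    case False
    have "Cauchy (\<lambda>k. \<sigma> k n)"
    proof (rule metric_CauchyI)
      fix e :: real assume e: "e > 0"
      have "e / (\<bar>K\<bar> + 1) > 0" using e by (simp add: add_nonneg_pos)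
      then obtain M where M: "\<And>m k. m \<ge> M \<Longrightarrow> k \<ge> M \<Longrightarrow> N (\<sigma> m - \<sigma> k) < e / (\<bar>K\<bar> + 1)"
        using cauchy by blast
      have "dist (\<sigma> m n) (\<sigma> k n) < e" if "m \<ge> M" "k \<ge> M" for m k
      proof -
        have d: "\<sigma> m - \<sigma> k \<in> X" using \<sigma> by (simp add: X_diff)
        have "dist (\<sigma> m n) (\<sigma> k n) \<le> K * N (\<sigma> m - \<sigma> k)"
          using coord_le_N[OF d, of n] False by (simp add: dist_norm)
        also have "\<dots> \<le> (\<bar>K\<bar> + 1) * N (\<sigma> m - \<sigma> k)"
          using N_nonneg[OF d] by (intro mult_right_mono) auto
        also have "\<dots> < (\<bar>K\<bar> + 1) * (e / (\<bar>K\<bar> + 1))"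
          using M[OF that] by (intro mult_strict_left_mono) auto
        also have "\<dots> = e" by simp
        finally show ?thesis .
      qed
      then show "\<exists>M. \<forall>m\<ge>M. \<forall>n'\<ge>M. dist (\<sigma> m n) (\<sigma> n' n) < e" by blast
    qed
    then show ?thesis by (simp add: Cauchy_convergent_iff)
  qed
  then obtain f where f: "\<And>n. (\<lambda>k. \<sigma> k n) \<longlonglongrightarrow> f n"
    unfolding convergent_def by metis
  have near: "\<exists>M. \<forall>k\<ge>M. \<forall>j. q j (\<sigma> k - f) \<le> e" if e: "e > 0" for e
  proof -
    obtain M where M: "\<And>m k. m \<ge> M \<Longrightarrow> k \<ge> M \<Longrightarrow> N (\<sigma> m - \<sigma> k) < e"
      using cauchy[OF e] by blast
    have "q j (\<sigma> k - f) \<le> e" if k: "k \<ge> M" for k j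
    proof (rule LIMSEQ_le_const2)
      show "(\<lambda>m. q j (\<sigma> k - \<sigma> m)) \<longlonglongrightarrow> q j (\<sigma> k - f)"
        by (rule q_cont) (auto intro!: tendsto_intros f)
      have "q j (\<sigma> k - \<sigma> m) \<le> e" if "m \<ge> M" for m
        using q_le_N[OF X_diff[OF \<sigma> \<sigma>], of j k m] M[OF k that] by simp
      then show "\<exists>M. \<forall>m\<ge>M. q j (\<sigma> k - \<sigma> m) \<le> e" by blast
    qed
    then show ?thesis by blast
  qed
  have "f 0 = 0"
    using f[of 0] \<sigma> LIMSEQ_unique[OF f[of 0], of 0] by (simp add: X_def)
  moreover have "\<exists>M. \<forall>m\<ge>M. \<forall>j. q j (f - trunc m f) \<le> e" if e: "e > 0" for e
  proof -
    have "e / 3 > 0" using e by simp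
    then obtain k where k: "\<And>j. q j (\<sigma> k - f) \<le> e / 3"
      using near by blast
    obtain M where M: "\<And>m j. m \<ge> M \<Longrightarrow> q j (\<sigma> k - trunc m (\<sigma> k)) \<le> e / 3"
      using \<sigma>[of k] \<open>e / 3 > 0\<close> unfolding X_def by blast
    have "q j (f - trunc m f) \<le> e" if "m \<ge> M" for m j
    proof -
      obtain i where i: "\<And>g. q j (trunc m g) = q i g" using q_trunc[of j m] by blast
      \<comment> \<open>The tail of \<open>\<sigma> k\<close> is small because
        \<open>\<sigma> k\<close> is in \<open>X\<close>. The truncated difference has the same size
        as the \<open>i\<close>-th seminorm of \<open>\<sigma> k - f\<close>, which is small
        uniformly in \<open>i\<close>.\<close>
      have "f - trunc m f = ((\<sigma> k - trunc m (\<sigma> k)) - (\<sigma> k - f)) + trunc m (\<sigma> k - f)"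
        by (simp add: trunc_diff algebra_simps)
      then have "q j (f - trunc m f) \<le> q j ((\<sigma> k - trunc m (\<sigma> k)) - (\<sigma> k - f)) + q i (\<sigma> k - f)"
        using q_add i by metis
      also have "\<dots> \<le> e"
        using q_diff[of j "\<sigma> k - trunc m (\<sigma> k)" "\<sigma> k - f"] M[OF that, of j] k[of j] k[of i]
        by linarith
      finally show ?thesis .
    qed
    then show ?thesis by blast
  qed
  ultimately have fX: "f \<in> X" by (simp add: X_def)
  have "(\<lambda>n. N (\<sigma> n - f)) \<longlonglongrightarrow> 0"
  proof (rule LIMSEQ_I)
    fix e :: real assume "e > 0"
    then obtain M where M: "\<And>k j. k \<ge> M \<Longrightarrow> q j (\<sigma> k - f) \<le> e / 2"
      using near[OF half_gt_zero[of e]] by blast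
    have "norm (N (\<sigma> k - f) - 0) < e" if "k \<ge> M" for k
      using N_le[OF M[OF that]] N_nonneg[OF X_diff[OF \<sigma> fX], of k] \<open>e > 0\<close> by simp
    then show "\<exists>M. \<forall>k\<ge>M. norm (N (\<sigma> k - f) - 0) < e" by blast
  qed
  with fX show ?thesis by blast
qed

lemma banach_space_X: "banach_space seq_scale X N"
proof -
  interpret vs: vector_space "seq_scale :: 'k \<Rightarrow> (nat \<Rightarrow> 'k) \<Rightarrow> nat \<Rightarrow> 'k"
    by (rule vector_space_seq_scale)
  show ?thesis
  proof
    show "vs.subspace X"
      using finite_support_in_X[of 0 0] by (auto simp: vs.subspace_def X_add X_scale)
    show "0 \<le> N f" if "f \<in> X" for f using that by (rule N_nonneg)
    show "N f = 0 \<longleftrightarrow> f = 0" if "f \<in> X" for f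
    proof
      assume "N f = 0"
      then have "f n = 0" for n
        using coord_le_N[OF that, of n] that by (cases "n = 0") (auto simp: X_def)
      then show "f = 0" by auto
    qed (simp add: N_zero)
    show "N (f + g) \<le> N f + N g" if "f \<in> X" "g \<in> X" for f g
      using that by (intro N_le order_trans[OF q_add] add_mono q_le_N)
    show "N (seq_scale c f) = norm c * N f" if f: "f \<in> X" for c f
    proof (rule antisym)
      show "N (seq_scale c f) \<le> norm c * N f"
        using f by (intro N_le) (auto simp: q_scale intro!: mult_left_mono q_le_N)
      show "norm c * N f \<le> N (seq_scale c f)"
      proof (cases "c = 0")
        case True
        then show ?thesis using N_nonneg[OF X_scale[OF f, of c]] by simp
      next
        case False
        have "N f \<le> N (seq_scale c f) / norm c"
        proof (rule N_le)
          fix j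
          show "q j f \<le> N (seq_scale c f) / norm c"
            using q_le_N[OF X_scale[OF f], of j c] False
            by (simp add: q_scale field_simps)
        qed
        then show ?thesis using False by (simp add: field_simps)
      qed
    qed
  qed (rule X_complete)
qed

section \<open>The unit vectors as a basis\<close>

lemma N_diff_trunc_tendsto:
  assumes f: "f \<in> X"
  shows "(\<lambda>m. N (f - trunc m f)) \<longlonglongrightarrow> 0"
proof (rule LIMSEQ_I)
  fix e :: real assume "e > 0"
  then obtain M where M: "\<And>k j. k \<ge> M \<Longrightarrow> q j (f - trunc k f) \<le> e / 2"
    using f half_gt_zero[of e] unfolding X_def by blast
  have "f - trunc k f \<in> X" for k
    using f by (intro X_diff trunc_in_X) (auto simp: X_def)
  then have "norm (N (f - trunc k f) - 0) < e" if "k \<ge> M" for k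
    using N_le[OF M[OF that]] N_nonneg[of "f - trunc k f"] \<open>e > 0\<close> by simp
  then show "\<exists>M. \<forall>k\<ge>M. norm (N (f - trunc k f) - 0) < e" by blast
qed

lemma schauder_basis_unit_seq: "schauder_basis seq_scale X N unit_seq"
  unfolding schauder_basis_def
proof (intro conjI allI impI ballI)
  fix f assume f: "f \<in> X"
  then have f0: "f 0 = 0" by (simp add: X_def)
  let ?P = "\<lambda>a. a \<in> extensional {1..} \<and>
    (\<lambda>m. N (f - (\<Sum>n\<in>{1..m}. seq_scale (a n) (unit_seq n)))) \<longlonglongrightarrow> 0"
  show "\<exists>!a. ?P a"
  proof (rule ex1I[of _ "restrict f {1..}"])
    have "(\<Sum>n\<in>{1..m}. seq_scale (restrict f {1..} n) (unit_seq n)) = trunc m f" for m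
      unfolding trunc_eq_sum[of f, OF f0] by (intro sum.cong) auto
    then show "?P (restrict f {1..})"
      using N_diff_trunc_tendsto[OF f] by simp
  next
    fix a assume a: "?P a"
    \<comment> \<open>An extensional \<open>a\<close> is \<open>undefined\<close> at
      \<open>0\<close>; resetting this value makes the partial sums truncations of \<open>g\<close>.
      For \<open>m \<ge> n\<close> the \<open>n\<close>-th coordinate of
      \<open>f - trunc m g\<close> is the fixed number \<open>f n - a n\<close>, while the norm of
      this difference tends to \<open>0\<close>.\<close>
    define g where "g = (\<lambda>n. if n = 0 then 0 else a n)"
    have g: "(\<Sum>n\<in>{1..m}. seq_scale (a n) (unit_seq n)) = trunc m g" for m
      by (subst trunc_eq_sum) (auto simp: g_def intro!: sum.cong)
    have "f n = a n" if n: "n \<ge> 1" for n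
    proof -
      have lim: "(\<lambda>m. K * N (f - trunc m g)) \<longlonglongrightarrow> 0"
        using a tendsto_mult_left[of _ 0 sequentially K] unfolding g by auto
      have "norm (f n - a n) \<le> K * N (f - trunc m g)" if "m \<ge> n" for m
      proof -
        have "f - trunc m g \<in> X"
          using f by (intro X_diff trunc_in_X) (auto simp: g_def)
        from coord_le_N[OF this n] show ?thesis
          using that n by (simp add: trunc_def g_def)
      qed
      then have "norm (f n - a n) \<le> 0"
        by (intro LIMSEQ_le_const[OF lim]) blast
      then show ?thesis by simp
    qed
    then show "a = restrict f {1..}"
      using a by (auto simp: fun_eq_iff extensional_def restrict_def)
  qed
qed (rule unit_seq_in_X)

lemma basis_unit_seq: "basis seq_scale X N unit_seq (\<lambda>n f. f n)"
proof -
  interpret vs: vector_space "seq_scale :: 'k \<Rightarrow> (nat \<Rightarrow> 'k) \<Rightarrow> nat \<Rightarrow> 'k"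
    by (rule vector_space_seq_scale)
  show ?thesis
    unfolding basis_def
  proof (intro conjI allI impI ballI)
    show "\<exists>C. \<forall>n\<ge>1. N (unit_seq n) \<le> C"
      using N_le q_unit by blast
    show "\<exists>g\<in>vs.span (unit_seq ` {1..}). N (f - g) < e" if f: "f \<in> X" and e: "e > 0" for f e
    proof -
      obtain m where "N (f - trunc m f) < e"
        using order_tendstoD(2)[OF N_diff_trunc_tendsto[OF f] e]
        by (auto simp: eventually_sequentially)
      moreover have "trunc m f \<in> vs.span (unit_seq ` {1..})"
        using f by (subst trunc_eq_sum) (simp add: X_def, intro vs.span_sum vs.span_scale vs.span_base, simp)
      ultimately show ?thesis by blast
    qed
    show "\<exists>C. \<forall>n\<ge>1. \<forall>f\<in>X. norm (f n) \<le> C * N f"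
      using coord_le_N by blast
  qed (auto simp: unit_seq_in_X linear_functional_on_def seq_scale_def, simp_all add: unit_seq_def)
qed

lemma finite_large_coords:
  assumes f: "f \<in> X" and e: "e > 0"
  shows "finite {n. e \<le> norm (f n)}"
proof -
  have "(\<lambda>m. K * N (f - trunc m f)) \<longlonglongrightarrow> 0"
    using tendsto_mult_left[OF N_diff_trunc_tendsto[OF f], of K] by simp
  from order_tendstoD(2)[OF this e] obtain m where m: "K * N (f - trunc m f) < e"
    by (auto simp: eventually_sequentially)
  have "f - trunc m f \<in> X"
    using f by (intro X_diff trunc_in_X) (auto simp: X_def)
  then have "norm (f n) < e" if "n > m" for n
    using coord_le_N[of "f - trunc m f" n] that m by (simp add: trunc_def)
  then have "{n. e \<le> norm (f n)} \<subseteq> {..m}"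
    by (force simp: not_less[symmetric])
  then show ?thesis by (rule finite_subset) simp
qed

lemma norm_coord_le_sup_norm:
  assumes "f \<in> X" "n \<ge> 1"
  shows "norm (f n) \<le> sup_norm (\<lambda>n f. f n) f"
  unfolding sup_norm_def
proof (rule cSUP_upper)
  show "bdd_above ((\<lambda>n. norm (f n)) ` {1..})"
    using coord_le_N[OF assms(1)] by (intro bdd_aboveI2[of _ _ "K * N f"]) auto
qed (use assms in auto)

end

section \<open>The block norm\<close>

locale block_structure =
  fixes a :: real and M :: "nat \<Rightarrow> nat"
  assumes a_pos: "0 < a" and a_le_1: "a \<le> 1" and M_ge: "4 ^ i \<le> M i"
begin

section \<open>Blocks, heads and tails\<close>

definition start :: "nat \<Rightarrow> nat" where
  "start i = (\<Sum>j<i. 2 ^ j + M j)"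

definition blk :: "nat \<Rightarrow> nat" where
  "blk n = (LEAST i. n < start (Suc i))"

definition in_head :: "nat \<Rightarrow> bool" where
  "in_head n \<longleftrightarrow> n < start (blk n) + 2 ^ blk n"

text \<open>
  This value is forced by \<open>head_cancels_tail\<close> below. The index \<open>0\<close> lies in the \<open>0\<close>-th head, which
  is harmless because the sequences in the space vanish there.
\<close>

definition coupling :: "nat \<Rightarrow> real" where
  "coupling i = real (M i) powr (- a) * (2 ^ i) powr (a - 1)"

text \<open>As a matrix, \<open>c\<close> has its rows indexed by the second argument: rows sum over
  heads, columns over tails.\<close>

definition c :: "nat \<Rightarrow> nat \<Rightarrow> real" where
  "c m n = (if in_head m \<and> \<not> in_head n \<and> blk m = blk n then coupling (blk n) else 0)"

lemma start_Suc: "start (Suc i) = start i + 2 ^ i + M i"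
  by (simp add: start_def)

lemma M_pos: "0 < M i"
  by (rule less_le_trans[OF _ M_ge]) simp

lemma mono_start: "mono start"
  by (rule monoI, rule lift_Suc_mono_le[of start]) (auto simp: start_Suc)

lemma le_start: "i \<le> start i"
proof (induction i)
  case (Suc i)
  then show ?case using M_pos[of i] by (simp add: start_Suc)
qed simp

lemma blk_bounds: "start (blk n) \<le> n" "n < start (Suc (blk n))"
proof -
  have "n < start (Suc n)"
    using le_start[of "Suc n"] by simp
  then show "n < start (Suc (blk n))"
    unfolding blk_def by (rule LeastI)
  show "start (blk n) \<le> n"
  proof (cases "blk n")
    case (Suc i)
    then have "\<not> n < start (Suc i)"
      using not_less_Least[of i "\<lambda>i. n < start (Suc i)"] by (simp add: blk_def)
    then show ?thesis using Suc by simp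
  qed (simp add: start_def)
qed

lemma blk_eqI:
  assumes "start i \<le> n" "n < start (Suc i)"
  shows "blk n = i"
proof (rule antisym)
  show "blk n \<le> i"
    unfolding blk_def using assms(2) by (rule Least_le)
  show "i \<le> blk n"
  proof (rule ccontr)
    assume "\<not> i \<le> blk n"
    then have "start (Suc (blk n)) \<le> start i"
      by (intro monoD[OF mono_start]) simp
    then show False using blk_bounds(2)[of n] assms(1) by simp
  qed
qed

lemma blk_mono: "m \<le> n \<Longrightarrow> blk m \<le> blk n"
  unfolding blk_def[of m] by (rule Least_le) (use blk_bounds(2)[of n] in simp)

lemma head_eq: "{n. in_head n \<and> blk n = i} = {start i..<start i + 2 ^ i}"
proof -
  have "in_head n \<and> blk n = i" if "start i \<le> n" "n < start i + 2 ^ i" for n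
    using blk_eqI[of i n] that by (simp add: in_head_def start_Suc)
  moreover have "start i \<le> n \<and> n < start i + 2 ^ i" if "in_head n" "blk n = i" for n
    using blk_bounds(1)[of n] that by (simp add: in_head_def)
  ultimately show ?thesis unfolding set_eq_iff atLeastLessThan_iff mem_Collect_eq by blast
qed

lemma tail_eq: "{n. \<not> in_head n \<and> blk n = i} = {start i + 2 ^ i..<start (Suc i)}"
proof -
  have "\<not> in_head n \<and> blk n = i" if "start i + 2 ^ i \<le> n" "n < start (Suc i)" for n
    using blk_eqI[of i n] that by (simp add: in_head_def)
  moreover have "start i + 2 ^ i \<le> n \<and> n < start (Suc i)" if "\<not> in_head n" "blk n = i" for n
    using blk_bounds(2)[of n] that by (simp add: in_head_def)
  ultimately show ?thesis unfolding set_eq_iff atLeastLessThan_iff mem_Collect_eq by blast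
qed

lemma card_head: "card {n. in_head n \<and> blk n = i} = 2 ^ i"
  and finite_head: "finite {n. in_head n \<and> blk n = i}"
  by (simp_all add: head_eq)

lemma card_tail: "card {n. \<not> in_head n \<and> blk n = i} = M i"
  and finite_tail: "finite {n. \<not> in_head n \<and> blk n = i}"
  by (simp_all add: tail_eq start_Suc)

text \<open>Hence \<open>c\<close> is strictly triangular, and the range \<open>m<n\<close> in
  \<open>L\<close> captures the whole head belonging to a tail index \<open>n\<close>.\<close>

lemma head_less_tail: "in_head m \<Longrightarrow> \<not> in_head n \<Longrightarrow> blk m = blk n \<Longrightarrow> m < n"
  by (simp add: in_head_def)

section \<open>Estimates for the coupling matrix\<close>

lemma coupling_pos: "0 < coupling i"
  using M_pos by (simp add: coupling_def)

lemma c_nonneg: "0 \<le> c m n"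
  using coupling_pos by (simp add: c_def less_imp_le)

lemma sum_c_rows:
  assumes "finite A" "\<not> in_head n"
  shows "(\<Sum>m\<in>A. c m n) = real (card {m\<in>A. in_head m \<and> blk m = blk n}) * coupling (blk n)"
  using assms by (simp add: c_def sum.If_cases Int_def)

lemma sum_c_columns:
  assumes "finite S" "in_head m"
  shows "(\<Sum>n\<in>S. c m n) = real (card {n\<in>S. \<not> in_head n \<and> blk n = blk m}) * coupling (blk m)"
proof -
  have "(\<Sum>n\<in>S. c m n) = (\<Sum>n\<in>S. if \<not> in_head n \<and> blk n = blk m then coupling (blk m) else 0)"
    using assms by (intro sum.cong) (auto simp: c_def)
  then show ?thesis using assms by (simp add: sum.If_cases Int_def)
qed

text \<open>A head has \<open>2 ^ i\<close> elements, so a row in block \<open>i\<close> sums to at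
  most \<open>(2 ^ i / M i) powr a\<close>; \<open>M_ge\<close> bounds this ratio by
  \<open>1 / 2 ^ i\<close>.\<close>

lemma row_sum_le: "(\<Sum>m<n. c m n) \<le> (1 / 2 ^ blk n) powr a"
proof (cases "in_head n")
  case False
  let ?i = "blk n"
  have "card {m\<in>{..<n}. in_head m \<and> blk m = ?i} \<le> 2 ^ ?i"
    unfolding card_head[symmetric] by (rule card_mono[OF finite_head]) auto
  then have "(\<Sum>m<n. c m n) \<le> 2 ^ ?i * coupling ?i"
    unfolding sum_c_rows[OF finite_lessThan False] using coupling_pos[of ?i]
    by (intro mult_right_mono) (simp_all add: numeral_power_le_of_nat_cancel_iff of_nat_le_numeral_power_cancel_iff)
  also have "\<dots> = (2 ^ ?i / M ?i) powr a"
    using M_pos[of ?i] by (simp add: coupling_def powr_diff powr_minus powr_divide field_simps)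
  also have "\<dots> \<le> (1 / 2 ^ ?i) powr a"
  proof (rule powr_mono2)
    have "(4::real) ^ ?i \<le> M ?i"
      using M_ge[of ?i] by (metis of_nat_le_iff of_nat_numeral of_nat_power)
    then have "2 ^ ?i * 2 ^ ?i \<le> real (M ?i)"
      by (simp add: power_mult_distrib[symmetric])
    then show "2 ^ ?i / real (M ?i) \<le> 1 / 2 ^ ?i"
      using M_pos[of ?i] by (simp add: field_simps)
  qed (use a_pos in auto)
  finally show ?thesis .
qed (simp add: c_def)

lemma finite_large_rows:
  assumes "0 < t"
  shows "finite {n. t < (\<Sum>m<n. c m n)}"
proof -
  have "(\<lambda>i. ((1 / 2) ^ i) powr a) \<longlonglongrightarrow> (0 :: real) powr a"
    using a_pos by (intro tendsto_powr' LIMSEQ_power_zero tendsto_const) auto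
  then have "(\<lambda>i. (1 / 2 ^ i) powr a) \<longlonglongrightarrow> (0 :: real)"
    by (simp add: power_one_over)
  from order_tendstoD(2)[OF this assms] obtain I where I: "\<And>i. i \<ge> I \<Longrightarrow> (1 / 2 ^ i) powr a < t"
    by (auto simp: eventually_sequentially)
  have "n < start I" if "t < (\<Sum>m<n. c m n)" for n
  proof (rule ccontr)
    assume "\<not> n < start I"
    have "I \<le> blk n"
    proof (rule ccontr)
      assume "\<not> I \<le> blk n"
      then have "start (Suc (blk n)) \<le> start I"
        by (intro monoD[OF mono_start]) simp
      then show False using blk_bounds(2)[of n] \<open>\<not> n < start I\<close> by simp
    qed
    then show False using I[of "blk n"] row_sum_le[of n] that by simp
  qed
  then have "{n. t < (\<Sum>m<n. c m n)} \<subseteq> {..<start I}" by auto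
  then show ?thesis by (rule finite_subset) simp
qed

text \<open>These are the head indices that an \<open>admissible\<close> set of size
  \<open>m\<close> must avoid. They lie in blocks below \<open>I\<close>, so there are at most
  \<open>2 ^ I - 1\<close> of them, and minimality of \<open>I\<close> gives
  \<open>2 * 2 ^ I < m\<close> if \<open>I > 0\<close>. The constant \<open>4\<close> in the
  Schreier condition thus limits the loss to half of \<open>m\<close>.\<close>

lemma card_early_heads:
  "finite {n. in_head n \<and> 4 * 2 ^ blk n < m}" (is "finite ?E")
  "2 * card {n. in_head n \<and> 4 * 2 ^ blk n < m} \<le> m"
proof -
  define I where "I = (LEAST i. m \<le> 4 * 2 ^ i)"
  have "m \<le> 4 * 2 ^ m" using less_exp[of m] by linarith
  then have I: "m \<le> 4 * 2 ^ I" unfolding I_def by (rule LeastI)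
  have sub: "?E \<subseteq> (\<Union>i<I. {n. in_head n \<and> blk n = i})"
  proof
    fix n assume n: "n \<in> ?E"
    have "blk n < I"
    proof (rule ccontr)
      assume "\<not> blk n < I"
      then have "(2::nat) ^ I \<le> 2 ^ blk n" by (intro power_increasing) auto
      then have "m \<le> 4 * 2 ^ blk n" using I by linarith
      then show False using n by simp
    qed
    then show "n \<in> (\<Union>i<I. {n. in_head n \<and> blk n = i})" using n by auto
  qed
  have fin: "finite (\<Union>i<I. {n. in_head n \<and> blk n = i})"
    using finite_head by blast
  show "finite ?E" using sub fin by (rule finite_subset)
  have "card ?E \<le> card (\<Union>i<I. {n. in_head n \<and> blk n = i})"
    using sub by (rule card_mono[OF fin])
  also have "\<dots> \<le> (\<Sum>i<I. 2 ^ i)"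
    using card_UN_le[of "{..<I}" "\<lambda>i. {n. in_head n \<and> blk n = i}"] by (simp add: card_head)
  also have "\<dots> = 2 ^ I - 1"
    by (induction I) auto
  finally have card: "card ?E \<le> 2 ^ I - 1" .
  show "2 * card ?E \<le> m"
  proof (cases I)
    case (Suc i)
    then have "\<not> m \<le> 4 * 2 ^ i"
      using not_less_Least[of i "\<lambda>i. m \<le> 4 * 2 ^ i"] by (simp add: I_def)
    then show ?thesis using card Suc by simp
  qed (use card in simp)
qed

text \<open>Both exponents in \<open>coupling\<close> are nonpositive, so replacing
  \<open>M i\<close> by \<open>l\<close> and \<open>2 ^ i\<close> by \<open>k\<close> can only
  enlarge it.\<close>

lemma coupling_row_bound:
  assumes "0 < k" "k \<le> 2 ^ i" "0 < l" "l \<le> real (M i)"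
  shows "k * coupling i \<le> (k / l) powr a" "l * coupling i \<le> (l / k) powr (1 - a)"
proof -
  have "coupling i \<le> l powr (- a) * k powr (a - 1)"
    unfolding coupling_def using assms a_pos a_le_1
    by (intro mult_mono powr_mono2') auto
  from mult_left_mono[OF this, of k] mult_left_mono[OF this, of l]
  show "k * coupling i \<le> (k / l) powr a" "l * coupling i \<le> (l / k) powr (1 - a)"
    using assms by (simp_all add: powr_diff powr_minus powr_divide field_simps)
qed

text \<open>
  A restricted weak-type estimate for \<open>c\<close>: in the \<open>i\<close>-th block, with \<open>k\<close> elements of \<open>A\<close> in the
  head and \<open>l\<close> elements of \<open>S\<close> in the tail, the rows are summed if \<open>k / l\<close> is at most
  \<open>card A / card S\<close>, and the columns otherwise.
\<close>

lemma sum_c_le: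
  assumes A: "finite A" and S: "finite S"
  shows "(\<Sum>n\<in>S. \<Sum>m\<in>A. c m n) \<le> 2 * real (card A) powr a * real (card S) powr (1 - a)"
proof (cases "A = {} \<or> S = {}")
  case False
  \<comment> \<open>This threshold balances the two estimates: \<open>card S * R powr a\<close> and
    \<open>card A * (1 / R) powr (1 - a)\<close> both equal
    \<open>card A powr a * card S powr (1 - a)\<close>, whence the factor \<open>2\<close>.\<close>
  define R where "R = real (card A) / real (card S)"
  have cards: "0 < real (card A)" "0 < real (card S)"
    using False A S by (auto simp: card_gt_0_iff)
  then have R: "0 < R" by (simp add: R_def)
  define k where "k i = real (card {m\<in>A. in_head m \<and> blk m = i})" for i
  define l where "l i = real (card {n\<in>S. \<not> in_head n \<and> blk n = i})" for i
  have k_le: "k i \<le> 2 ^ i" for i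
  proof -
    have "card {m\<in>A. in_head m \<and> blk m = i} \<le> card {m. in_head m \<and> blk m = i}"
      by (rule card_mono[OF finite_head]) auto
    then show ?thesis by (simp add: k_def card_head of_nat_le_numeral_power_cancel_iff)
  qed
  have l_le: "l i \<le> M i" for i
  proof -
    have "card {n\<in>S. \<not> in_head n \<and> blk n = i} \<le> card {n. \<not> in_head n \<and> blk n = i}"
      by (rule card_mono[OF finite_tail]) auto
    then show ?thesis by (simp add: l_def card_tail)
  qed
  define G where "G = {n\<in>S. k (blk n) \<le> R * l (blk n)}"
  have l_pos: "0 < l (blk n)" if "n \<in> S" "\<not> in_head n" for n
    using that S by (auto simp: l_def card_gt_0_iff)
  have k_pos: "0 < k (blk m)" if "m \<in> A" "in_head m" for m
    using that A by (auto simp: k_def card_gt_0_iff)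
  have row: "(\<Sum>m\<in>A. c m n) \<le> R powr a" if n: "n \<in> G" for n
  proof (cases "in_head n \<or> k (blk n) = 0")
    case True
    then show ?thesis
      using sum_c_rows[OF A, of n] by (cases "in_head n") (simp_all add: k_def, simp add: c_def)
  next
    case False
    then have l: "0 < l (blk n)" using l_pos[of n] n by (simp add: G_def)
    have k: "0 < k (blk n)" using False by (simp add: k_def)
    have "(\<Sum>m\<in>A. c m n) = k (blk n) * coupling (blk n)"
      using sum_c_rows[OF A, of n] False by (simp add: k_def)
    also have "\<dots> \<le> (k (blk n) / l (blk n)) powr a"
      by (rule coupling_row_bound(1)[OF k k_le l l_le])
    also have "\<dots> \<le> R powr a"
      using k l n a_pos by (intro powr_mono2) (auto simp: G_def field_simps)
    finally show ?thesis .
  qed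
  have column: "(\<Sum>n\<in>S - G. c m n) \<le> (1 / R) powr (1 - a)" if m: "m \<in> A" for m
  proof (cases "(\<exists>n\<in>S - G. \<not> in_head n \<and> blk n = blk m) \<and> in_head m")
    case False
    then have "c m n = 0" if "n \<in> S - G" for n
      using that by (auto simp: c_def)
    then show ?thesis by simp
  next
    case True
    then obtain n where n: "n \<in> S - G" "\<not> in_head n" "blk n = blk m" by blast
    then have l: "0 < l (blk m)" using l_pos[of n] by auto
    have k: "0 < k (blk m)" using k_pos m True by simp
    have "(\<Sum>n\<in>S - G. c m n) \<le> (\<Sum>n\<in>S. c m n)"
      using S c_nonneg by (intro sum_mono2) auto
    also have "\<dots> = l (blk m) * coupling (blk m)"
      using sum_c_columns[OF S, of m] True by (simp add: l_def)
    also have "\<dots> \<le> (l (blk m) / k (blk m)) powr (1 - a)"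
      by (rule coupling_row_bound(2)[OF k k_le l l_le])
    also have "\<dots> \<le> (1 / R) powr (1 - a)"
      using k l n R a_le_1 by (intro powr_mono2) (auto simp: G_def field_simps)
    finally show ?thesis .
  qed
  have "(\<Sum>n\<in>S. \<Sum>m\<in>A. c m n) = (\<Sum>n\<in>G. \<Sum>m\<in>A. c m n) + (\<Sum>n\<in>S - G. \<Sum>m\<in>A. c m n)"
    using S by (subst add.commute, intro sum.subset_diff) (auto simp: G_def)
  also have "(\<Sum>n\<in>S - G. \<Sum>m\<in>A. c m n) = (\<Sum>m\<in>A. \<Sum>n\<in>S - G. c m n)"
    by (rule sum.swap)
  also have "(\<Sum>n\<in>G. \<Sum>m\<in>A. c m n) + \<dots> \<le> (\<Sum>n\<in>G. R powr a) + (\<Sum>m\<in>A. (1 / R) powr (1 - a))"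
    by (intro add_mono sum_mono row column)
  also have "\<dots> \<le> card S * R powr a + card A * (1 / R) powr (1 - a)"
    using S by (auto simp: G_def intro!: mult_right_mono card_mono)
  also have "\<dots> = 2 * real (card A) powr a * real (card S) powr (1 - a)"
    using cards by (simp add: R_def powr_divide powr_diff field_simps)
  finally show ?thesis .
qed auto

section \<open>The seminorms and their upper bound\<close>

definition L :: "(nat \<Rightarrow> 'k::real_normed_field) \<Rightarrow> nat \<Rightarrow> 'k" where
  "L f n = f n - (\<Sum>m<n. of_real (c m n) * f m)"

definition admissible :: "nat set \<Rightarrow> bool" where
  "admissible S \<longleftrightarrow> finite S \<and> (\<forall>n\<in>S. in_head n \<longrightarrow> card S \<le> 4 * 2 ^ blk n)"

text \<open>The weighted sums give the usual norm of weak \<open>\<ell>\<^sub>p\<close> with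
  \<open>p = 1 / a\<close> (of \<open>\<ell>\<^sub>1\<close> if \<open>a = 1\<close>), applied after
  \<open>L\<close>. Having the truncation in the index closes the family under truncation; the value
  \<open>0\<close> for inadmissible sets lets all pairs serve as indices.\<close>

definition q :: "nat \<times> nat set \<Rightarrow> (nat \<Rightarrow> 'k::real_normed_field) \<Rightarrow> real" where
  "q = (\<lambda>(m, S) f. if admissible S
     then real (card S) powr (a - 1) * (\<Sum>n\<in>S. norm (L (trunc m f) n)) else 0)"

lemma q_eq: "admissible S \<Longrightarrow>
    q (m, S) f = real (card S) powr (a - 1) * (\<Sum>n\<in>S. norm (L (trunc m f) n))"
  by (simp add: q_def)

lemma L_add: "L (\<lambda>n. f n + g n) n = L f n + L g n"
  by (simp add: L_def algebra_simps sum.distrib)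

lemma L_scale: "L (seq_scale b f) n = b * L f n"
  by (simp add: L_def seq_scale_def algebra_simps sum_distrib_left)

lemma L_of_real: "L (\<lambda>n. of_real (h n)) n = (of_real (L h n) :: 'k::real_normed_field)"
  by (simp add: L_def)

lemma L_cong: "(\<And>m. m \<le> n \<Longrightarrow> f m = g m) \<Longrightarrow> L f n = L g n"
  by (auto simp: L_def intro!: sum.cong arg_cong2[of _ _ _ _ "(-)"])

lemma L_in_head: "in_head n \<Longrightarrow> L f n = f n"
  by (simp add: L_def c_def)

lemma norm_sum_c_le:
  fixes f :: "nat \<Rightarrow> 'k::real_normed_field"
  shows "norm (\<Sum>m<n. of_real (c m n) * f m) \<le> (\<Sum>m<n. c m n * norm (f m))"
  by (rule order_trans[OF norm_sum]) (simp add: norm_mult c_nonneg)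

lemma admissible_singleton: "admissible {n}"
  by (simp add: admissible_def)

text \<open>The diagonal part counts \<open>S \<inter> A\<close>; splitting this cardinality into
  its powers \<open>a\<close> and \<open>1 - a\<close>, bounded by those of \<open>card A\<close>
  and \<open>card S\<close>, contributes \<open>1\<close>. The coupling contributes \<open>2\<close>
  by \<open>sum_c_le\<close>, and \<open>card S powr (1 - a)\<close> cancels the weight in
  \<open>q\<close>.\<close>

lemma q_le:
  fixes g :: "nat \<Rightarrow> 'k::real_normed_field"
  assumes s: "0 \<le> s" and g: "\<And>n. norm (g n) \<le> s" and A: "finite A" "\<And>n. n \<notin> A \<Longrightarrow> g n = 0"
  shows "q j g \<le> 3 * s * real (card A) powr a"
proof (cases "\<exists>m S. j = (m, S) \<and> admissible S \<and> S \<noteq> {}")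
  case False
  then show ?thesis using s by (cases j) (auto simp: q_def)
next
  case True
  then obtain m S where j: "j = (m, S)" "admissible S" "S \<noteq> {}" by blast
  then have S: "finite S" "0 < real (card S)"
    by (auto simp: admissible_def card_gt_0_iff)
  define h where "h = trunc m g"
  have h: "norm (h n) \<le> s" "n \<notin> A \<Longrightarrow> h n = 0" for n
    using g s A(2) by (auto simp: h_def trunc_def)
  have L_le: "norm (L h n) \<le> norm (h n) + s * (\<Sum>m\<in>A. c m n)" for n
  proof -
    have "(\<Sum>m<n. c m n * norm (h m)) = (\<Sum>m\<in>{..<n} \<inter> A. c m n * norm (h m))"
      by (rule sum.mono_neutral_right) (auto simp: h(2))
    also have "\<dots> \<le> (\<Sum>m\<in>A. c m n * norm (h m))"
      by (rule sum_mono2[OF A(1)]) (auto simp: c_nonneg)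
    also have "\<dots> \<le> (\<Sum>m\<in>A. s * c m n)"
      using h(1) by (intro sum_mono) (subst mult.commute, auto intro!: mult_right_mono c_nonneg)
    finally have "(\<Sum>m<n. c m n * norm (h m)) \<le> s * (\<Sum>m\<in>A. c m n)"
      by (simp add: sum_distrib_left)
    then show ?thesis
      using norm_triangle_ineq4[of "h n" "\<Sum>m<n. of_real (c m n) * h m"] norm_sum_c_le[of n h]
      unfolding L_def by linarith
  qed
  have "(\<Sum>n\<in>S. norm (h n)) = (\<Sum>n\<in>S \<inter> A. norm (h n))"
    using S(1) by (intro sum.mono_neutral_right) (auto simp: h(2))
  also have "\<dots> \<le> (\<Sum>n\<in>S \<inter> A. s)"
    by (intro sum_mono h(1))
  also have "\<dots> = s * (real (card (S \<inter> A)) powr a * real (card (S \<inter> A)) powr (1 - a))"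
    by (simp add: powr_add[symmetric])
  also have "\<dots> \<le> s * (real (card A) powr a * real (card S) powr (1 - a))"
    using s S(1) A(1) a_pos a_le_1
    by (intro mult_left_mono mult_mono powr_mono2) (auto intro: card_mono)
  finally have diag: "(\<Sum>n\<in>S. norm (h n)) \<le> s * (real (card A) powr a * real (card S) powr (1 - a))" .
  have "(\<Sum>n\<in>S. norm (L h n)) \<le> (\<Sum>n\<in>S. norm (h n)) + s * (\<Sum>n\<in>S. \<Sum>m\<in>A. c m n)"
    using sum_mono[of S, OF L_le] by (simp add: sum.distrib sum_distrib_left)
  also have "\<dots> \<le> s * (real (card A) powr a * real (card S) powr (1 - a))
      + s * (2 * real (card A) powr a * real (card S) powr (1 - a))"
    by (intro add_mono diag mult_left_mono sum_c_le A S s)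
  also have "\<dots> = 3 * s * real (card A) powr a * real (card S) powr (1 - a)"
    by simp
  finally have "q j g \<le> real (card S) powr (a - 1) *
      (3 * s * real (card A) powr a * real (card S) powr (1 - a))"
    unfolding j(1) q_eq[OF j(2)] h_def by (rule mult_left_mono) simp
  also have "\<dots> = 3 * s * real (card A) powr a * (real (card S) powr (a - 1) * real (card S) powr (1 - a))"
    by simp
  also have "\<dots> = 3 * s * real (card A) powr a"
    using S(2) by (simp add: powr_add[symmetric])
  finally show ?thesis .
qed

text \<open>Truncating at \<open>n\<close> instead of \<open>n - 1\<close> changes the diagonal term
  of \<open>L\<close> at \<open>n\<close> but not the sum over \<open>m<n\<close>, so
  \<open>f n\<close> is a difference of two values controlled by the admissible set
  \<open>{n}\<close>.\<close>

lemma norm_coord_le: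
  fixes f :: "nat \<Rightarrow> 'k::real_normed_field"
  assumes n: "1 \<le> n" and r: "\<And>j. q j f \<le> r"
  shows "norm (f n) \<le> 2 * r"
proof -
  have L_le: "norm (L (trunc m f) n) \<le> r" for m
    using r[of "(m, {n})"] by (simp add: q_eq admissible_singleton)
  have "L (trunc n f) n = f n - (\<Sum>m<n. of_real (c m n) * f m)"
    "L (trunc (n - 1) f) n = - (\<Sum>m<n. of_real (c m n) * f m)"
    using n by (auto simp: L_def trunc_def intro!: sum.cong)
  then have "f n = L (trunc n f) n - L (trunc (n - 1) f) n" by simp
  then show ?thesis
    using norm_triangle_ineq4[of "L (trunc n f) n" "L (trunc (n - 1) f) n"] L_le[of n] L_le[of "n - 1"]
    by simp
qed

text \<open>The constant \<open>3\<close> is \<open>q_le\<close> for a one-point support, and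
  \<open>2\<close> comes from \<open>norm_coord_le\<close>.\<close>

lemma seminorm_family_q:
  "seminorm_family (q :: nat \<times> nat set \<Rightarrow> (nat \<Rightarrow> 'k::{real_normed_field,banach}) \<Rightarrow> real) 3 2"
proof
  fix j :: "nat \<times> nat set" and f g :: "nat \<Rightarrow> 'k"
  obtain m S where j: "j = (m, S)" by force
  show "q j (f + g) \<le> q j f + q j g"
  proof (cases "admissible S")
    case True
    have eq: "trunc m (f + g) = (\<lambda>n. trunc m f n + trunc m g n)"
      by (simp add: trunc_def fun_eq_iff)
    have "L (trunc m (f + g)) n = L (trunc m f) n + L (trunc m g) n" for n
      unfolding eq by (rule L_add)
    then have "(\<Sum>n\<in>S. norm (L (trunc m (f + g)) n))
        \<le> (\<Sum>n\<in>S. norm (L (trunc m f) n)) + (\<Sum>n\<in>S. norm (L (trunc m g) n))"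
      by (auto simp: sum.distrib[symmetric] intro!: sum_mono norm_triangle_ineq)
    from mult_left_mono[OF this, of "real (card S) powr (a - 1)"] show ?thesis
      using True by (simp add: j q_eq algebra_simps)
  qed (simp add: j q_def)
next
  fix j :: "nat \<times> nat set" and b and f :: "nat \<Rightarrow> 'k"
  show "q j (seq_scale b f) = norm b * q j f"
    by (cases j) (simp add: q_def trunc_scale L_scale norm_mult sum_distrib_left algebra_simps)
next
  fix j :: "nat \<times> nat set" and m
  obtain k S where j: "j = (k, S)" by force
  have "\<forall>f. q j (trunc m f) = q (min k m, S) (f :: nat \<Rightarrow> 'k)"
    by (simp add: j q_def trunc_trunc)
  then show "\<exists>i. \<forall>f. q j (trunc m f) = q i (f :: nat \<Rightarrow> 'k)" by blast
next
  fix n and j :: "nat \<times> nat set"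
  show "q j (unit_seq n :: nat \<Rightarrow> 'k) \<le> 3"
    by (rule order_trans[OF q_le[of 1 _ "{n}"]]) (auto simp: unit_seq_def)
next
  fix n :: nat and f :: "nat \<Rightarrow> 'k" and r :: real
  assume "1 \<le> n" "\<And>j. q j f \<le> r"
  then show "norm (f n) \<le> 2 * r" by (rule norm_coord_le)
next
  fix \<sigma> :: "nat \<Rightarrow> nat \<Rightarrow> 'k" and f and j :: "nat \<times> nat set"
  assume lim: "\<And>n. (\<lambda>k. \<sigma> k n) \<longlonglongrightarrow> f n"
  obtain m S where j: "j = (m, S)" by force
  have "(\<lambda>k. trunc m (\<sigma> k) n) \<longlonglongrightarrow> trunc m f n" for n
    using lim by (simp add: trunc_def)
  then have "(\<lambda>k. L (trunc m (\<sigma> k)) n) \<longlonglongrightarrow> L (trunc m f) n" for n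
    unfolding L_def by (intro tendsto_intros)
  then show "(\<lambda>k. q j (\<sigma> k)) \<longlonglongrightarrow> q j f"
    by (cases "admissible S") (auto simp: j q_def intro!: tendsto_intros)
qed

section \<open>Lower bounds for the norm\<close>

lemma lower_bound_admissible:
  fixes f :: "nat \<Rightarrow> 'k::real_normed_field"
  assumes r: "\<And>j. q j f \<le> r" and S: "admissible S" and b: "\<And>n. n \<in> S \<Longrightarrow> b \<le> norm (L f n)"
  shows "b * real (card S) powr a \<le> r"
proof (cases "S = {}")
  case True
  have "q (0, {}) f = 0" by (simp add: q_def)
  then show ?thesis using r[of "(0, {})"] True by simp
next
  case False
  have fin: "finite S" using S by (simp add: admissible_def)
  then have pos: "0 < real (card S)" using False by (simp add: card_gt_0_iff)
  \<comment> \<open>\<open>L f n\<close> depends only on the entries up to \<open>n\<close>, so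
    truncating at \<open>Max S\<close> is invisible on \<open>S\<close>.\<close>
  have eq: "L (trunc (Max S) f) n = L f n" if "n \<in> S" for n
    using Max_ge[OF fin that] by (intro L_cong) (simp add: trunc_def)
  have "b * real (card S) powr a = real (card S) powr (a - 1) * (\<Sum>n\<in>S. b)"
    using pos by (simp add: powr_diff)
  also have "\<dots> \<le> real (card S) powr (a - 1) * (\<Sum>n\<in>S. norm (L (trunc (Max S) f) n))"
    using b eq by (intro mult_left_mono sum_mono) auto
  also have "\<dots> \<le> r"
    using r[of "(Max S, S)"] by (simp add: q_eq S)
  finally show ?thesis .
qed

definition large_rows :: "real \<Rightarrow> nat set" where
  "large_rows t = {n. t / 2 < (\<Sum>m<n. c m n)}"

text \<open>The two summands belong to the two cases that conclude
  \<open>lower_bound_top_level\<close>.\<close>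

definition lower_constant :: "real \<Rightarrow> real" where
  "lower_constant t = 8 / t + 8 * real (card (large_rows t)) / t"

lemma lower_constant_pos: "0 < t \<Longrightarrow> 0 < lower_constant t"
  by (simp add: lower_constant_def add_pos_nonneg)

text \<open>
  Since \<open>f\<close> is bounded by \<open>s\<close>, the operator \<open>L\<close> changes a coordinate of size at least \<open>t * s\<close> by
  more than half of it only at the finitely many indices whose row sum of \<open>c\<close> exceeds \<open>t / 2\<close>.
\<close>

lemma lower_bound_top_level:
  fixes f :: "nat \<Rightarrow> 'k::real_normed_field"
  assumes t: "0 < t" and s: "0 < s" and f0: "f 0 = 0" and f: "\<And>n. norm (f n) \<le> s"
    and A: "finite A" and level: "\<And>n. n \<in> A \<Longrightarrow> t * s \<le> norm (f n)" and r: "\<And>j. q j f \<le> r"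
  shows "s * real (card A) powr a \<le> lower_constant t * r"
proof (cases "A = {}")
  case True
  have "q (0, {}) f = 0" by (simp add: q_def)
  then have "0 \<le> r" using r[of "(0, {})"] by simp
  then show ?thesis using True t by (simp add: lower_constant_def)
next
  case False
  then obtain n where n: "n \<in> A" by blast
  have finite_large: "finite (large_rows t)"
    unfolding large_rows_def using t by (intro finite_large_rows) simp
  have r_large: "s \<le> 2 / t * r"
  proof -
    have "0 < t * s" using t s by simp
    then have "f n \<noteq> 0" using level[OF n] by auto
    then have "1 \<le> n" using f0 by (cases n) auto
    then have "t * s \<le> 2 * r" using norm_coord_le[of n f r] r level[OF n] by simp
    then show ?thesis using t by (simp add: field_simps)
  qed
  then have r0: "0 \<le> r" using s t by (smt (verit) mult_less_cancel_left_pos zero_less_divide_iff mult_pos_neg)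
  have A1: "1 \<le> real (card A)" using A n by (simp add: card_gt_0_iff Suc_le_eq) blast
  \<comment> \<open>Removing \<open>H\<close> makes the rest admissible, since its size is at most
    \<open>card A\<close>, and costs at most half of \<open>A\<close> by
    \<open>card_early_heads\<close>.\<close>
  define H where "H = {n. in_head n \<and> 4 * 2 ^ blk n < card A}"
  define S where "S = A - large_rows t - H"
  have S: "admissible S"
  proof -
    have "card S \<le> card A" using A by (auto simp: S_def intro: card_mono)
    then show ?thesis using A by (auto simp: admissible_def S_def H_def)
  qed
  have "card A \<le> card (S \<union> large_rows t \<union> H)"
    using A finite_large card_early_heads(1)[of "card A"] by (intro card_mono) (auto simp: S_def H_def)
  also have "\<dots> \<le> card S + card (large_rows t) + card H"
    by (meson add_le_mono1 card_Un_le order_trans)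
  finally have card: "card A \<le> 2 * card S + 2 * card (large_rows t)"
    using card_early_heads(2)[of "card A"] by (simp add: H_def)
  have half: "t * s / 2 \<le> norm (L f n)" if "n \<in> S" for n
  proof -
    have "(\<Sum>m<n. c m n * norm (f m)) \<le> (\<Sum>m<n. c m n * s)"
      by (intro sum_mono mult_left_mono f c_nonneg)
    also have "\<dots> = s * (\<Sum>m<n. c m n)" by (simp add: sum_distrib_left mult.commute)
    also have "\<dots> \<le> s * (t / 2)"
      using that s by (intro mult_left_mono) (auto simp: S_def large_rows_def)
    finally have "norm (\<Sum>m<n. of_real (c m n) * f m) \<le> t * s / 2"
      using norm_sum_c_le[of n f] by (simp add: mult.commute)
    then show ?thesis
      using norm_triangle_ineq2[of "f n" "\<Sum>m<n. of_real (c m n) * f m"] level[of n] that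
      by (simp add: L_def S_def)
  qed
  have lower: "t * s / 2 * real (card S) powr a \<le> r"
    by (rule lower_bound_admissible[OF r S half])
  show ?thesis
  \<comment> \<open>If less than a quarter of \<open>A\<close> survives in \<open>S\<close>, then
    the count above gives \<open>card A \<le> 4 * card (large_rows t)\<close>, and the
    one-coordinate estimate \<open>r_large\<close> suffices.\<close>
  proof (cases "card A \<le> 4 * card S")
    case True
    have "real (card A) powr a \<le> (4 * real (card S)) powr a"
      using True a_pos by (intro powr_mono2) auto
    also have "\<dots> = 4 powr a * real (card S) powr a" by (simp add: powr_mult)
    also have "\<dots> \<le> 4 * real (card S) powr a"
      using powr_mono[of a 1 4] a_le_1 by (intro mult_right_mono) auto
    finally have "s * real (card A) powr a \<le> s * (4 * real (card S) powr a)"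
      using s by (intro mult_left_mono) auto
    also have "\<dots> \<le> 8 / t * r" using lower t by (simp add: field_simps)
    also have "\<dots> \<le> lower_constant t * r" using r0 t by (intro mult_right_mono) (auto simp: lower_constant_def)
    finally show ?thesis .
  next
    case False
    have "real (card A) powr a \<le> real (card A)"
      using powr_mono[OF a_le_1 A1] A1 by simp
    also have "\<dots> \<le> 4 * real (card (large_rows t))" using card False by simp
    finally have "s * real (card A) powr a \<le> s * (4 * real (card (large_rows t)))"
      using s by (intro mult_left_mono) auto
    also have "\<dots> \<le> 2 / t * r * (4 * real (card (large_rows t)))"
      using r_large by (intro mult_right_mono) auto
    also have "\<dots> \<le> lower_constant t * r" using r0 t by (simp add: lower_constant_def field_simps)
    finally show ?thesis .
  qed
qed

section \<open>A bounded vector with a large restriction to a level set\<close>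

lemma head_cancels_tail:
  "2 ^ i * (coupling i * (1 / 2 ^ i) powr a) = (1 / real (M i)) powr a"
proof -
  have "(2::real) ^ i * ((2 ^ i) powr (a - 1) * (1 / 2 ^ i) powr a) = 1"
    by (simp add: powr_diff powr_divide)
  then show ?thesis
    by (simp add: coupling_def powr_minus powr_divide) (metis divide_inverse mult.assoc mult.commute mult.left_neutral mult_1)
qed

text \<open>On each block from \<open>I\<close>, head and tail are flat vectors of
  \<open>\<ell>\<^sub>p\<close> norm \<open>1\<close>, where \<open>p = 1 / a\<close>.\<close>

definition spread :: "nat set \<Rightarrow> nat \<Rightarrow> real" where
  "spread I n = (if blk n \<in> I then if in_head n then (1 / 2 ^ blk n) powr a
     else (1 / M (blk n)) powr a else 0)"

lemma spread_nonneg: "0 \<le> spread I n"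
  by (simp add: spread_def)

lemma spread_tail:
  "\<not> in_head n \<Longrightarrow> spread I n = (if blk n \<in> I then (1 / M (blk n)) powr a else 0)"
  by (simp add: spread_def)

text \<open>Together with \<open>spread_tail\<close> this shows that \<open>L (spread I)\<close>
  vanishes on all tails.\<close>

lemma sum_c_spread:
  assumes "\<not> in_head n"
  shows "(\<Sum>m<n. c m n * spread I m) = (if blk n \<in> I then (1 / M (blk n)) powr a else 0)"
proof -
  let ?i = "blk n" and ?H = "{m. in_head m \<and> blk m = blk n}"
  have "(\<Sum>m<n. c m n * spread I m) = (\<Sum>m\<in>?H. c m n * spread I m)"
    using assms head_less_tail[of _ n] by (intro sum.mono_neutral_right) (auto simp: c_def)
  also have "\<dots> = (\<Sum>m\<in>?H. if ?i \<in> I then coupling ?i * (1 / 2 ^ ?i) powr a else 0)"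
    using assms by (intro sum.cong) (auto simp: c_def spread_def)
  also have "\<dots> = (if ?i \<in> I then (1 / M ?i) powr a else 0)"
    using head_cancels_tail[of ?i] by (simp add: card_head)
  finally show ?thesis .
qed

text \<open>
  The tails cancel in every block lying entirely to the left of the truncation point, so that only
  one tail contributes to \<open>L (trunc m (spread I))\<close>.
\<close>

lemma norm_L_trunc_spread:
  assumes "\<not> in_head n"
  shows "\<bar>L (trunc m (spread I)) n\<bar> \<le> (if blk n = blk m then (1 / M (blk n)) powr a else 0)"
proof -
  let ?s = "\<Sum>k<n. c k n * trunc m (spread I) k"
  have L: "L (trunc m (spread I)) n = trunc m (spread I) n - ?s"
    by (simp add: L_def)
  consider "blk n < blk m" | "blk m < blk n" | "blk n = blk m" by linarith
  then show ?thesis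
  proof cases
    case 1
    then have nm: "n \<le> m" using blk_mono[of m n] by (meson not_le nat_le_linear)
    then have "?s = (\<Sum>k<n. c k n * spread I k)"
      by (intro sum.cong) (auto simp: trunc_def)
    moreover have "trunc m (spread I) n = spread I n"
      using nm by (simp add: trunc_def)
    ultimately show ?thesis
      by (simp add: L sum_c_spread[OF assms] spread_tail[OF assms])
  next
    case 2
    then have "\<not> k \<le> m" if "blk k = blk n" for k
      using blk_mono[of k m] that by auto
    then have "?s = 0" "trunc m (spread I) n = 0"
      by (auto simp: c_def trunc_def intro!: sum.neutral)
    then show ?thesis by (simp add: L)
  next
    \<comment> \<open>The truncation may cut this block anywhere. The entry and the subtracted sum
      both lie between \<open>0\<close> and the tail value, which therefore bounds their
      difference.\<close>
    case 3
    have "?s \<le> (\<Sum>k<n. c k n * spread I k)"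
      by (intro sum_mono mult_left_mono c_nonneg) (simp add: trunc_def spread_nonneg)
    also have "\<dots> \<le> (1 / M (blk n)) powr a"
      unfolding sum_c_spread[OF assms] by simp
    finally have "?s \<le> (1 / M (blk n)) powr a" .
    moreover have "0 \<le> ?s"
      by (intro sum_nonneg mult_nonneg_nonneg c_nonneg) (simp add: trunc_def spread_nonneg)
    moreover have "0 \<le> trunc m (spread I) n" "trunc m (spread I) n \<le> (1 / M (blk n)) powr a"
      using assms by (auto simp: trunc_def spread_def)
    ultimately show ?thesis using 3 by (simp add: L)
  qed
qed

text \<open>The bound is \<open>4\<close> for heads plus \<open>1\<close> for tails. Admissibility
  makes every head entry in \<open>S\<close> at most \<open>(4 / card S) powr a\<close>, so the
  heads give at most \<open>4 powr a\<close>. Of the tails only the one in the block of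
  \<open>m\<close> survives, and it has at most \<open>M (blk m)\<close> entries.\<close>

lemma q_spread_le: "q j (\<lambda>n. of_real (spread I n) :: 'k::real_normed_field) \<le> 5"
proof (cases "\<exists>m S. j = (m, S) \<and> admissible S \<and> S \<noteq> {}")
  case False
  then show ?thesis by (cases j) (auto simp: q_def)
next
  case True
  then obtain m S where j: "j = (m, S)" "admissible S" "S \<noteq> {}" by blast
  then have S: "finite S" "0 < real (card S)"
    by (auto simp: admissible_def card_gt_0_iff)
  define H where "H = {n\<in>S. in_head n}"
  define T where "T = {n\<in>S. \<not> in_head n \<and> blk n = blk m}"
  define x where "x n = norm (L (trunc m (\<lambda>n. of_real (spread I n) :: 'k)) n)" for n
  have x: "x n = \<bar>L (trunc m (spread I)) n\<bar>" for n
  proof -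
    have "trunc m (\<lambda>n. of_real (spread I n) :: 'k) = (\<lambda>n. of_real (trunc m (spread I) n))"
      by (simp add: trunc_def fun_eq_iff)
    then show ?thesis by (simp add: x_def L_of_real)
  qed
  have "(\<Sum>n\<in>H. x n) \<le> (\<Sum>n\<in>H. (4 / real (card S)) powr a)"
  proof (rule sum_mono)
    fix n assume n: "n \<in> H"
    then have "card S \<le> 4 * 2 ^ blk n" using j(2) by (simp add: H_def admissible_def)
    then have "real (card S) \<le> real (4 * 2 ^ blk n)"
      by (rule of_nat_mono)
    then have "real (card S) \<le> 4 * 2 ^ blk n" by simp
    then have "(1 / 2 ^ blk n) powr a \<le> (4 / real (card S)) powr a"
      using S(2) a_pos by (intro powr_mono2) (auto simp: field_simps)
    moreover have "x n \<le> (1 / 2 ^ blk n) powr a"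
      using n by (simp add: x L_in_head H_def trunc_def spread_def)
    ultimately show "x n \<le> (4 / real (card S)) powr a" by linarith
  qed
  also have "\<dots> \<le> real (card S) * (4 / real (card S)) powr a"
    using S(1) by (auto simp: H_def intro!: mult_right_mono card_mono)
  finally have "real (card S) powr (a - 1) * (\<Sum>n\<in>H. x n)
      \<le> real (card S) powr (a - 1) * (real (card S) * (4 / real (card S)) powr a)"
    by (rule mult_left_mono) simp
  also have "\<dots> = 4 powr a"
    using S(2) by (simp add: powr_diff powr_divide)
  also have "\<dots> \<le> 4"
    using powr_mono[of a 1 4] a_le_1 by simp
  finally have heads: "real (card S) powr (a - 1) * (\<Sum>n\<in>H. x n) \<le> 4" .
  have tails: "real (card S) powr (a - 1) * (\<Sum>n\<in>T. x n) \<le> 1"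
  proof (cases "T = {}")
    case False
    have finT: "finite T" using S(1) by (simp add: T_def)
    then have T: "0 < real (card T)" using False by (simp add: card_gt_0_iff)
    have "card T \<le> card {n. \<not> in_head n \<and> blk n = blk m}"
      by (rule card_mono[OF finite_tail]) (auto simp: T_def)
    then have "card T \<le> M (blk m)" by (simp add: card_tail)
    then have T_le: "real (card T) / M (blk m) \<le> 1"
      using M_pos[of "blk m"] by simp
    have "(\<Sum>n\<in>T. x n) \<le> (\<Sum>n\<in>T. (1 / M (blk m)) powr a)"
    proof (rule sum_mono)
      fix n assume "n \<in> T"
      then show "x n \<le> (1 / M (blk m)) powr a"
        using norm_L_trunc_spread[of n m I] by (simp add: T_def x)
    qed
    \<comment> \<open>Since \<open>T\<close> is part of \<open>S\<close> and
      \<open>a - 1 \<le> 0\<close>, the weight of \<open>T\<close> dominates that of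
      \<open>S\<close>.\<close>
    then have "real (card S) powr (a - 1) * (\<Sum>n\<in>T. x n)
        \<le> real (card T) powr (a - 1) * (real (card T) * (1 / M (blk m)) powr a)"
      using S T a_le_1 by (intro mult_mono powr_mono2')
        (auto simp: T_def x intro!: card_mono sum_nonneg)
    also have "\<dots> = (real (card T) / M (blk m)) powr a"
      using T by (simp add: powr_diff powr_divide)
    also have "\<dots> \<le> 1"
      using T_le a_pos by (intro powr_le1) auto
    finally show ?thesis .
  qed simp
  have "x n = 0" if "n \<in> S - (H \<union> T)" for n
    using norm_L_trunc_spread[of n m I] that by (auto simp: H_def T_def x)
  then have "(\<Sum>n\<in>S. x n) = (\<Sum>n\<in>H \<union> T. x n)"
    using S(1) by (intro sum.mono_neutral_right) (auto simp: H_def T_def)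
  also have "\<dots> = (\<Sum>n\<in>H. x n) + (\<Sum>n\<in>T. x n)"
    using S(1) by (intro sum.union_disjoint) (auto simp: H_def T_def)
  finally show ?thesis
    using heads tails by (simp add: j q_eq x_def distrib_left)
qed

definition tails :: "nat set \<Rightarrow> nat set" where
  "tails I = {n. \<not> in_head n \<and> blk n \<in> I}"

lemma finite_tails: "finite I \<Longrightarrow> finite (tails I)"
proof -
  assume "finite I"
  moreover have "tails I = (\<Union>i\<in>I. {n. \<not> in_head n \<and> blk n = i})"
    by (auto simp: tails_def)
  ultimately show ?thesis using finite_tail by simp
qed

lemma card_tails:
  assumes "finite I"
  shows "card (tails I) = (\<Sum>i\<in>I. M i)"
proof -
  have eq: "tails I = (\<Union>i\<in>I. {n. \<not> in_head n \<and> blk n = i})"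
    by (auto simp: tails_def)
  show ?thesis
    unfolding eq using assms finite_tail by (subst card_UN_disjoint) (auto simp: card_tail)
qed

lemma tails_ge_1: "n \<in> tails I \<Longrightarrow> 1 \<le> n"
  by (cases n) (auto simp: tails_def in_head_def)

text \<open>After restriction to tails no head is left to subtract, so \<open>L\<close> acts as the
  identity on \<open>A\<close>, which is admissible because it contains no head index. With
  \<open>card A = k * M i\<close> the seminorm equals \<open>k powr a\<close>.\<close>

lemma level_set_projection_large:
  fixes C :: real
  assumes runs: "\<And>k. \<exists>i>0. \<forall>j\<in>{i..<i + k}. M j = M i"
  obtains f :: "nat \<Rightarrow> 'k::real_normed_field" and A m b j where
    "f 0 = 0" "\<forall>n>m. f n = 0" "\<forall>i. q i f \<le> 5"
    "finite A" "A \<noteq> {}" "A \<subseteq> {1..}" "0 < b" "\<forall>n\<in>A. norm (f n) = b"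
    "C < q j (\<lambda>n. if n \<in> A then f n else 0)"
proof -
  obtain k :: nat where k: "max C 0 powr (1 / a) < k"
    using reals_Archimedean2 by blast
  obtain i where i: "0 < i" "\<And>j. j \<in> {i..<i + k} \<Longrightarrow> M j = M i"
    using runs by blast
  have "0 \<le> max C 0 powr (1 / a)" by simp
  then have k0: "0 < k" using k by linarith
  define I where "I = {i..<i + k}"
  define A where "A = tails I"
  define m where "m = start (i + k)"
  define f :: "nat \<Rightarrow> 'k" where "f n = of_real (spread I n)" for n
  define b where "b = (1 / M i) powr a"
  have "blk 0 = 0" by (rule blk_eqI) (auto simp: start_def)
  \<comment> \<open>Index \<open>0\<close> lies in block \<open>0\<close>, which
    \<open>0 < i\<close> keeps out of \<open>I\<close>.\<close>
  then have f0: "f 0 = 0" using i(1) by (simp add: f_def spread_def I_def)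
  have A_le_m: "n \<le> m" if "blk n \<in> I" for n
  proof -
    have "start (Suc (blk n)) \<le> m"
      unfolding m_def using that by (intro monoD[OF mono_start]) (simp add: I_def)
    then show ?thesis using blk_bounds(2)[of n] by simp
  qed
  have f_supp: "f n = 0" if "m < n" for n
  proof -
    have "blk n \<notin> I" using A_le_m[of n] that by linarith
    then show ?thesis by (simp add: f_def spread_def)
  qed
  have finA: "finite A" unfolding A_def I_def by (rule finite_tails) simp
  have fA: "f n = of_real b" if "n \<in> A" for n
    using that i(2)[of "blk n"] by (simp add: f_def spread_def A_def tails_def b_def I_def)
  have "card A = (\<Sum>j\<in>I. M j)"
    unfolding A_def by (rule card_tails) (simp add: I_def)
  also have "\<dots> = (\<Sum>j\<in>I. M i)"
    by (rule sum.cong[OF refl]) (rule i(2), simp add: I_def)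
  finally have card: "card A = k * M i" by (simp add: I_def)
  then have card_pos: "0 < card A" using k0 M_pos by simp
  have adm: "admissible A"
    using finA by (auto simp: admissible_def A_def tails_def)
  let ?g = "\<lambda>n. if n \<in> A then f n else 0"
  have L_g: "L (trunc m ?g) n = of_real b" if n: "n \<in> A" for n
  proof -
    have "(\<Sum>l<n. of_real (c l n) * trunc m ?g l) = (0 :: 'k)"
      by (rule sum.neutral) (auto simp: trunc_def c_def A_def tails_def)
    moreover have "trunc m ?g n = of_real b"
      using n A_le_m[of n] fA[OF n] by (simp add: trunc_def A_def tails_def)
    ultimately show ?thesis by (simp add: L_def)
  qed
  have "C \<le> max C 0" by simp
  also have "\<dots> = (max C 0 powr (1 / a)) powr a"
    using a_pos by (simp add: powr_powr)
  also have "\<dots> < real k powr a"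
    using k a_pos by (intro powr_less_mono2) auto
  also have "\<dots> = (real k * real (M i)) powr a * b"
    using M_pos[of i] by (simp add: b_def powr_mult powr_divide)
  also have "\<dots> = real (card A) powr (a - 1) * (real (card A) * b)"
    using card_pos by (simp add: powr_diff card[symmetric] flip: of_nat_mult)
  also have "\<dots> = q (m, A) ?g"
    using L_g by (simp add: q_eq[OF adm] b_def)
  finally have big: "C < q (m, A) ?g" .
  show thesis
  proof (rule that)
    show "f 0 = 0" by (rule f0)
    show "\<forall>n>m. f n = 0" using f_supp by blast
    show "\<forall>i. q i f \<le> 5" unfolding f_def using q_spread_le by blast
    show "finite A" by (rule finA)
    show "A \<noteq> {}" using card_pos by auto
    show "A \<subseteq> {1..}" using tails_ge_1 by (auto simp: A_def)
    show "0 < b" using M_pos[of i] by (simp add: b_def)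
    show "\<forall>n\<in>A. norm (f n) = b" using fA by (simp add: b_def)
    show "C < q (m, A) ?g" by (rule big)
  qed
qed

end

section \<open>The basis\<close>

text \<open>The witness is \<open>4 ^ 2 ^ e i\<close> with \<open>e i\<close> the bit length of
  \<open>i\<close>. It is constant on \<open>{2 ^ k..<2 ^ Suc k}\<close>, an interval longer than
  \<open>k\<close>, and \<open>i < 2 ^ e i\<close> gives the growth.\<close>

lemma long_constant_runs:
  obtains M :: "nat \<Rightarrow> nat"
  where "\<And>i. 4 ^ i \<le> M i" "\<And>k. \<exists>i>0. \<forall>j\<in>{i..<i + k}. M j = M i"
proof -
  define e :: "nat \<Rightarrow> nat" where "e i = (LEAST l. i < 2 ^ l)" for i
  have e: "i < 2 ^ e i" for i
    unfolding e_def by (rule LeastI[of _ i]) (rule less_exp)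
  have e_eq: "e j = Suc k" if "j \<in> {2 ^ k..<2 ^ Suc k}" for j k
    unfolding e_def
  proof (rule Least_equality)
    show "j < 2 ^ Suc k" using that by simp
    fix l assume "j < 2 ^ l"
    with that have "(2::nat) ^ k < 2 ^ l"
      unfolding atLeastLessThan_iff by linarith
    then show "Suc k \<le> l" by (simp add: Suc_le_eq)
  qed
  have run: "\<exists>i>0. \<forall>j\<in>{i..<i + k}. (4::nat) ^ 2 ^ e j = 4 ^ 2 ^ e i" for k
  proof (intro exI[of _ "2 ^ k"] conjI ballI)
    fix j assume "j \<in> {2 ^ k..<2 ^ k + k}"
    moreover have "k < 2 ^ k" by (rule less_exp)
    ultimately have "j \<in> {2 ^ k..<2 ^ Suc k}"
      unfolding atLeastLessThan_iff power_Suc by linarith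
    then show "(4::nat) ^ 2 ^ e j = 4 ^ 2 ^ e (2 ^ k)"
      using e_eq[of j k] e_eq[of "2 ^ k" k] by simp
  qed simp
  have "4 ^ i \<le> (4::nat) ^ 2 ^ e i" for i
    using e[of i] by (intro power_increasing) auto
  then show thesis using run by (rule that)
qed

lemma osc_const:
  assumes "finite A" "A \<noteq> {}" "\<And>n. n \<in> A \<Longrightarrow> norm (\<phi> n f) = b" "0 < b"
  shows "osc \<phi> f A = 1"
proof -
  have "(\<lambda>n. norm (\<phi> n f)) ` A = {b}"
    using assms by (auto simp: image_def)
  then show ?thesis using assms(4) by (simp add: osc_def one_ereal_def)
qed

text \<open>The instance \<open>d = D = 1\<close> with a one-piece partition, for which
  \<open>n \<le> Min (P 1)\<close> becomes \<open>1 \<le> Min A\<close>. The property will already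
  fail on sets of coordinates of constant modulus.\<close>

lemma bounded_oscillation_unconditional_D:
  assumes "bounded_oscillation_unconditional scl X N x \<phi>"
  obtains C where "\<And>f A. f \<in> X \<Longrightarrow> finite A \<Longrightarrow> A \<noteq> {} \<Longrightarrow> A \<subseteq> {1..} \<Longrightarrow> osc \<phi> f A \<le> 1 \<Longrightarrow>
    N (coord_proj scl x \<phi> A f) \<le> C * N f"
proof -
  obtain C where C: "\<forall>f\<in>X. \<forall>A. finite A \<and> A \<noteq> {} \<and> A \<subseteq> {1..} \<and> osc \<phi> f A \<le> ereal 1 \<and>
          (\<exists>n\<ge>1. \<exists>P. A = (\<Union>j\<in>{1..n}. P j) \<and> disjoint_family_on P {1..n} \<and>
             (\<forall>j\<in>{1..n}. P j \<noteq> {} \<and> osc \<phi> f (P j) \<le> ereal 1) \<and>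
             n \<le> Min (P 1) \<and>
             (\<forall>j\<in>{1..<n}. Max (P j) < Min (P (Suc j))))
          \<longrightarrow> N (coord_proj scl x \<phi> A f) \<le> C * N f"
    using assms[unfolded bounded_oscillation_unconditional_def, THEN spec[where x = 1],
        THEN spec[where x = 1], THEN mp, OF conjI[OF order_refl order_refl]]
    by (rule exE)
  have "N (coord_proj scl x \<phi> A f) \<le> C * N f"
    if f: "f \<in> X" and A: "finite A" "A \<noteq> {}" "A \<subseteq> {1..}" "osc \<phi> f A \<le> 1" for f A
  proof (rule C[THEN bspec[OF _ f], THEN spec, THEN mp], intro conjI)
    have "1 \<le> Min A" using A by auto
    then show "\<exists>n\<ge>1. \<exists>P. A = (\<Union>j\<in>{1..n}. P j) \<and> disjoint_family_on P {1..n} \<and>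
             (\<forall>j\<in>{1..n}. P j \<noteq> {} \<and> osc \<phi> f (P j) \<le> ereal 1) \<and>
             n \<le> Min (P 1) \<and> (\<forall>j\<in>{1..<n}. Max (P j) < Min (P (Suc j)))"
      using A by (intro exI[of _ "1::nat"] conjI exI[of _ "\<lambda>_. A"])
        (auto simp: disjoint_family_on_def one_ereal_def)
  qed (use A in \<open>simp_all add: one_ereal_def\<close>)
  then show thesis by (rule that)
qed

text \<open>The scalars form any complete normed field, which covers \<open>real\<close> and
  \<open>complex\<close> at once. Near unconditionality and the two-sided estimate both result from
  comparing \<open>q_le\<close> and \<open>lower_bound_top_level\<close> with
  \<open>s * card A powr a\<close>.\<close>

lemma nearly_not_bounded_oscillation_basis:
  fixes p :: real
  assumes p: "1 \<le> p"
  shows "\<exists>(X :: (nat \<Rightarrow> 'k::{real_normed_field,banach}) set) N x \<phi>.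
       banach_space seq_scale X N \<and>
       schauder_basis seq_scale X N x \<and> basis seq_scale X N x \<phi> \<and>
       nearly_unconditional seq_scale X N x \<phi> \<and>
       \<not> bounded_oscillation_unconditional seq_scale X N x \<phi> \<and>
       (\<exists>C\<ge>1. \<forall>A \<epsilon>. finite A \<and> A \<subseteq> {1..} \<and> (\<forall>n\<in>A. norm (\<epsilon> n) = 1) \<longrightarrow>
          1 / C * real (card A) powr (1 / p) \<le> N (\<Sum>n\<in>A. seq_scale (\<epsilon> n) (x n)) \<and>
          N (\<Sum>n\<in>A. seq_scale (\<epsilon> n) (x n)) \<le> C * real (card A) powr (1 / p))"
proof -
  obtain M :: "nat \<Rightarrow> nat" where M: "\<And>i. 4 ^ i \<le> M i" "\<And>k. \<exists>i>0. \<forall>j\<in>{i..<i + k}. M j = M i"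
    by (rule long_constant_runs[OF that])
  define a where "a = 1 / p"
  interpret block_structure a M
    using p M(1) by unfold_locales (auto simp: a_def)
  interpret seminorm_family "q :: nat \<times> nat set \<Rightarrow> (nat \<Rightarrow> 'k) \<Rightarrow> real" 3 2
    by (rule seminorm_family_q)
  let ?\<phi> = "\<lambda>n f. f n :: 'k"
  have nearly: "nearly_unconditional seq_scale X N unit_seq ?\<phi>"
    unfolding nearly_unconditional_def
  proof (intro allI impI, elim conjE)
    fix t :: real assume "0 < t"
    show "\<exists>C>0. \<forall>f\<in>X. \<forall>s>0. sup_norm ?\<phi> f \<le> s \<longrightarrow>
        (\<forall>A\<subseteq>level_set ?\<phi> f (t * s) s. N (coord_proj seq_scale unit_seq ?\<phi> A f) \<le> C * N f)"
    proof (intro exI[of _ "3 * lower_constant t"] conjI ballI allI impI)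
      fix f s A
      assume f: "f \<in> X" and s: "0 < s" and sup: "sup_norm ?\<phi> f \<le> s"
        and A: "A \<subseteq> level_set ?\<phi> f (t * s) s"
      have f0: "f 0 = 0" using f by (simp add: X_def)
      have f_le: "norm (f n) \<le> s" for n
        using norm_coord_le_sup_norm[OF f, of n] sup f0 s by (cases "n = 0") auto
      have level: "t * s \<le> norm (f n)" if "n \<in> A" for n
        using A that by (auto simp: level_set_def)
      then have "A \<subseteq> {n. t * s \<le> norm (f n)}" by blast
      then have finA: "finite A"
        using finite_large_coords[OF f, of "t * s"] \<open>0 < t\<close> s finite_subset by auto
      have lower: "s * real (card A) powr a \<le> lower_constant t * N f"
        by (rule lower_bound_top_level[OF \<open>0 < t\<close> s f0 f_le finA level q_le_N[OF f]])
      have "N (\<lambda>n. if n \<in> A then f n else 0) \<le> 3 * s * real (card A) powr a"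
        by (rule N_le, rule q_le) (use s f_le finA in auto)
      also have "\<dots> \<le> 3 * lower_constant t * N f" using lower by simp
      finally show "N (coord_proj seq_scale unit_seq ?\<phi> A f) \<le> 3 * lower_constant t * N f"
        by (simp add: coord_proj_unit_seq[OF finA])
    qed (use lower_constant_pos[OF \<open>0 < t\<close>] in simp)
  qed
  have not_bou: "\<not> bounded_oscillation_unconditional seq_scale X N unit_seq ?\<phi>"
  proof
    assume bou: "bounded_oscillation_unconditional seq_scale X N unit_seq ?\<phi>"
    obtain C where C: "\<And>f A. f \<in> X \<Longrightarrow> finite A \<Longrightarrow> A \<noteq> {} \<Longrightarrow> A \<subseteq> {1..} \<Longrightarrow>
        osc ?\<phi> f A \<le> 1 \<Longrightarrow> N (coord_proj seq_scale unit_seq ?\<phi> A f) \<le> C * N f"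
      by (rule bounded_oscillation_unconditional_D[OF bou that])
    obtain f :: "nat \<Rightarrow> 'k" and A m b j where
      f: "f 0 = 0" "\<forall>n>m. f n = 0" "\<forall>i. q i f \<le> 5"
      and A: "finite A" "A \<noteq> {}" "A \<subseteq> {1..}"
      and b: "0 < b" "\<forall>n\<in>A. norm (f n) = b"
      and big: "max C 0 * 5 < q j (\<lambda>n. if n \<in> A then f n else 0)"
      by (rule level_set_projection_large[OF M(2) that])
    have fX: "f \<in> X" by (rule finite_support_in_X[of _ m]) (use f in auto)
    let ?g = "\<lambda>n. if n \<in> A then f n else 0"
    have gX: "?g \<in> X" by (rule finite_support_in_X[of _ m]) (use f in auto)
    have "osc ?\<phi> f A = 1" using A b by (intro osc_const) auto
    then have "N ?g \<le> C * N f"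
      using C[OF fX A] by (simp add: coord_proj_unit_seq[OF A(1)])
    \<comment> \<open>\<open>C\<close> comes without a sign, hence \<open>max C 0\<close>.\<close>
    also have "\<dots> \<le> max C 0 * 5"
      using N_le[of f 5] f(3) N_nonneg[OF fX] by (intro mult_mono) auto
    also have "\<dots> < q j ?g" by (rule big)
    also have "\<dots> \<le> N ?g" by (rule q_le_N[OF gX])
    finally show False by simp
  qed
  have democratic: "\<exists>C\<ge>1. \<forall>A \<epsilon>. finite A \<and> A \<subseteq> {1..} \<and> (\<forall>n\<in>A. norm (\<epsilon> n) = 1) \<longrightarrow>
      1 / C * real (card A) powr (1 / p) \<le> N (\<Sum>n\<in>A. seq_scale (\<epsilon> n) (unit_seq n)) \<and>
      N (\<Sum>n\<in>A. seq_scale (\<epsilon> n) (unit_seq n)) \<le> C * real (card A) powr (1 / p)"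
  proof -
    let ?C = "lower_constant 1"
    show ?thesis
    \<comment> \<open>The upper estimate uses the \<open>3\<close> of \<open>q_le\<close>, which
      also makes the constant at least \<open>1\<close>.\<close>
    proof (intro exI[of _ "max ?C 3"] conjI allI impI)
      fix A and \<epsilon> :: "nat \<Rightarrow> 'k"
      assume "finite A \<and> A \<subseteq> {1..} \<and> (\<forall>n\<in>A. norm (\<epsilon> n) = 1)"
      then have A: "finite A" "A \<subseteq> {1..}" and \<epsilon>: "\<And>n. n \<in> A \<Longrightarrow> norm (\<epsilon> n) = 1" by auto
      define g where "g n = (if n \<in> A then \<epsilon> n else 0)" for n
      have g_eq: "(\<Sum>n\<in>A. seq_scale (\<epsilon> n) (unit_seq n)) = g"
        using coord_proj_unit_seq[OF A(1), of \<epsilon>] by (simp add: coord_proj_def g_def[abs_def])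
      have g0: "g 0 = 0" using A(2) by (auto simp: g_def)
      have g_le: "norm (g n) \<le> 1" for n using \<epsilon> by (simp add: g_def)
      have gX: "g \<in> X"
        using Max_ge[OF A(1)] by (intro finite_support_in_X[of g "Max A", OF g0]) (force simp: g_def)
      have N0: "0 \<le> N g" by (rule N_nonneg[OF gX])
      have "1 * real (card A) powr a \<le> ?C * N g"
        by (rule lower_bound_top_level[OF zero_less_one zero_less_one g0 g_le A(1) _ q_le_N[OF gX]]) (simp add: g_def \<epsilon>)
      also have "\<dots> \<le> max ?C 3 * N g" using N0 by (intro mult_right_mono) auto
      finally show "1 / max ?C 3 * real (card A) powr (1 / p) \<le> N (\<Sum>n\<in>A. seq_scale (\<epsilon> n) (unit_seq n))"
        unfolding g_eq by (simp add: a_def field_simps)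
      have "N g \<le> 3 * 1 * real (card A) powr a"
        by (rule N_le, rule q_le) (use g_le A in \<open>auto simp: g_def\<close>)
      also have "\<dots> \<le> max ?C 3 * real (card A) powr a"
        by (intro mult_right_mono) auto
      finally show "N (\<Sum>n\<in>A. seq_scale (\<epsilon> n) (unit_seq n)) \<le> max ?C 3 * real (card A) powr (1 / p)"
        unfolding g_eq by (simp add: a_def)
    qed simp
  qed
  show ?thesis
    by (intro exI[of _ X] exI[of _ N] exI[of _ unit_seq] exI[of _ ?\<phi>] conjI banach_space_X
        schauder_basis_unit_seq basis_unit_seq nearly not_bou democratic)
qed

theorem theorem1p6:
  shows "((\<exists>(X :: (nat \<Rightarrow> real) set) N x \<phi>.
       banach_space seq_scale X N \<and>
       schauder_basis seq_scale X N x \<and> basis seq_scale X N x \<phi> \<and>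
       nearly_unconditional seq_scale X N x \<phi> \<and>
       \<not> bounded_oscillation_unconditional seq_scale X N x \<phi>) \<and>
     (\<forall>p::real. 1 \<le> p \<longrightarrow>
      (\<exists>(X :: (nat \<Rightarrow> real) set) N x \<phi>.
       banach_space seq_scale X N \<and>
       schauder_basis seq_scale X N x \<and> basis seq_scale X N x \<phi> \<and>
       nearly_unconditional seq_scale X N x \<phi> \<and>
       \<not> bounded_oscillation_unconditional seq_scale X N x \<phi> \<and>
       (\<exists>C\<ge>1. \<forall>A \<epsilon>. finite A \<and> A \<subseteq> {1..} \<and> (\<forall>n\<in>A. norm (\<epsilon> n) = 1) \<longrightarrow>
          1 / C * real (card A) powr (1 / p) \<le> N (\<Sum>n\<in>A. seq_scale (\<epsilon> n) (x n)) \<and>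
          N (\<Sum>n\<in>A. seq_scale (\<epsilon> n) (x n)) \<le> C * real (card A) powr (1 / p))))) \<and>
    ((\<exists>(X :: (nat \<Rightarrow> complex) set) N x \<phi>.
       banach_space seq_scale X N \<and>
       schauder_basis seq_scale X N x \<and> basis seq_scale X N x \<phi> \<and>
       nearly_unconditional seq_scale X N x \<phi> \<and>
       \<not> bounded_oscillation_unconditional seq_scale X N x \<phi>) \<and>
     (\<forall>p::real. 1 \<le> p \<longrightarrow>
      (\<exists>(X :: (nat \<Rightarrow> complex) set) N x \<phi>.
       banach_space seq_scale X N \<and>
       schauder_basis seq_scale X N x \<and> basis seq_scale X N x \<phi> \<and>
       nearly_unconditional seq_scale X N x \<phi> \<and>
       \<not> bounded_oscillation_unconditional seq_scale X N x \<phi> \<and>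
       (\<exists>C\<ge>1. \<forall>A \<epsilon>. finite A \<and> A \<subseteq> {1..} \<and> (\<forall>n\<in>A. norm (\<epsilon> n) = 1) \<longrightarrow>
          1 / C * real (card A) powr (1 / p) \<le> N (\<Sum>n\<in>A. seq_scale (\<epsilon> n) (x n)) \<and>
          N (\<Sum>n\<in>A. seq_scale (\<epsilon> n) (x n)) \<le> C * real (card A) powr (1 / p)))))"
\<comment> \<open>The claims without an exponent follow from \<open>p = 1\<close> by dropping the
  two-sided estimate.\<close>
proof (intro conjI allI impI)
  show "\<exists>(X :: (nat \<Rightarrow> real) set) N x \<phi>.
       banach_space seq_scale X N \<and>
       schauder_basis seq_scale X N x \<and> basis seq_scale X N x \<phi> \<and>
       nearly_unconditional seq_scale X N x \<phi> \<and>
       \<not> bounded_oscillation_unconditional seq_scale X N x \<phi>"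
    using nearly_not_bounded_oscillation_basis[OF order_refl] by (elim exE conjE) (intro exI conjI; assumption)
  show "\<exists>(X :: (nat \<Rightarrow> complex) set) N x \<phi>.
       banach_space seq_scale X N \<and>
       schauder_basis seq_scale X N x \<and> basis seq_scale X N x \<phi> \<and>
       nearly_unconditional seq_scale X N x \<phi> \<and>
       \<not> bounded_oscillation_unconditional seq_scale X N x \<phi>"
    using nearly_not_bounded_oscillation_basis[OF order_refl] by (elim exE conjE) (intro exI conjI; assumption)
qed (erule nearly_not_bounded_oscillation_basis)+

end
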